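(* Let $E$ be an oriented vector bundle over $\mathbf R^m$ ($m\ge2$) of rank $4$, $h$ a neutral metric of $E$ and $\nabla$ a flat $h$-connection of $E$. Let $e=(e_1,e_2,e_3,e_4)$ be an ordered pseudo-orthonormal frame field of $E$ giving the orientation of $E$, let $\omega=[\omega^i_j]$ be the connection form of $\nabla$ with respect to $e$ ($\nabla e=e\omega$), and let $\varepsilon\in\{+,-\}$. The following two conditions are equivalent: (a) the covariant derivative $\hat\nabla\Omega_{\varepsilon,2}$ is fully light-like; (b) there are functions $f^\varepsilon,g^\varepsilon$ on $\mathbf R^m$ with $dg^\varepsilon\neq0$ (at every point) and $\mu\in\{+,-\}$ such that $$\omega^4_1=\varepsilon e^{\mu f^\varepsilon}dg^\varepsilon-\varepsilon\omega^3_2,\qquad \omega^4_2=\varepsilon\omega^3_1-df^\varepsilon,\qquad \omega^4_3=\mu e^{\mu f^\varepsilon}dg^\varepsilon-\varepsilon\omega^2_1$$ and $$d\omega^2_1=2\omega^3_1\wedge\omega^3_2-e^{\mu f^\varepsilon}\omega^3_1\wedge dg^\varepsilon+\varepsilon\omega^3_2\wedge df^\varepsilon+\varepsilon e^{\mu f^\varepsilon}df^\varepsilon\wedge dg^\varepsilon,$$ $$d\omega^3_1=2\omega^2_1\wedge\omega^3_2-e^{\mu f^\varepsilon}\omega^2_1\wedge dg^\varepsilon+\varepsilon\mu e^{\mu f^\varepsilon}\omega^3_2\wedge dg^\varepsilon,$$ $$d\omega^3_2=-2\omega^2_1\wedge\omega^3_1+\varepsilon\omega^2_1\wedge df^\varepsilon-\varepsilon\mu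 e^{\mu f^\varepsilon}\omega^3_1\wedge dg^\varepsilon+\mu e^{\mu f^\varepsilon}df^\varepsilon\wedge dg^\varepsilon.$$ In addition, if one of (a), (b) holds, then $\hat\nabla\Omega_{\varepsilon,2}=\alpha\otimes\Omega_0$, where $$\alpha:=e^{\mu f^\varepsilon}dg^\varepsilon,\qquad \Omega_0:=\Omega_{-\varepsilon,1}+\mu\,\Omega_{\varepsilon,3}$$ (with $f^\varepsilon,g^\varepsilon,\mu$ as in (b)), and $\Omega_0$ can be horizontal for a suitable frame field, i.e. there is an ordered pseudo-orthonormal frame field $e'$ of $E$ giving the orientation, with the same $\Omega_{\varepsilon,2}$, such that the section $\Omega_0$ defined from $e'$ satisfies $\hat\nabla\Omega_0=0$.
   Context: Signs $\varepsilon,\mu\in\{+,-\}$ are identified with $\pm1$. A neutral metric of a rank-$4$ bundle has signature $(2,2)$; an $h$-connection satisfies $\nabla h=0$; flat means zero curvature. An ordered pseudo-orthonormal frame field $(e_1,e_2,e_3,e_4)$ has $e_1,e_2$ space-like ($h(e_i,e_i)=1$) and $e_3,e_4$ time-like ($h(e_i,e_i)=-1$). $\hat h$ and $\hat\nabla$ are the metric and connection of $\bigwedge^2E$ induced by $h$ and $\nabla$. For such a frame, $$\Omega_{\pm,1}:=\tfrac1{\sqrt2}(e_1\wedge e_2\pm e_3\wedge e_4),\ \ \Omega_{\pm,2}:=\tfrac1{\sqrt2}(e_1\wedge e_3\pm e_4\wedge e_2),\ \ \Omega_{\pm,3}:=\tfrac1{\sqrt2}(e_1\wedge e_4\pm e_2\wedge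 e_3).$$ $\Omega_{\varepsilon,2}$ is a section of the time-like twistor space $\{\theta\in\bigwedge^2_\varepsilon E:\hat h(\theta,\theta)=-1\}$, where $\bigwedge^2_\varepsilon E$ is the rank-$3$ subbundle of $\bigwedge^2E$ spanned by $\Omega_{-\varepsilon,1},\Omega_{\varepsilon,2},\Omega_{\varepsilon,3}$ for positively oriented frames. For a section $\Omega$ of this twistor space, $\hat\nabla\Omega$ is fully light-like if at each point $p$, $\hat\nabla_v\Omega$ is light-like or zero with respect to $\hat h$ for every tangent vector $v$ at $p$, and is nonzero for some $v$ (so $\hat\nabla\Omega$ determines a light-like line at each point). *)

theory Defs
  imports "HOL-Analysis.Analysis"
begin

(* Meant for open S and a finite-dimensional domain, where this is C^k on S in the usual sense. *)

fun Ck_on :: "nat \<Rightarrow> 'a::real_normed_vector set \<Rightarrow> ('a \<Rightarrow> 'b::real_normed_vector) \<Rightarrow> bool" where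
  "Ck_on 0 S f \<longleftrightarrow> continuous_on S f"
| "Ck_on (Suc k) S f \<longleftrightarrow>
     (\<forall>x\<in>S. f differentiable (at x)) \<and> (\<forall>v. Ck_on k S (\<lambda>x. frechet_derivative f (at x) v))"

definition smooth_on :: "'a::real_normed_vector set \<Rightarrow> ('a \<Rightarrow> 'b::real_normed_vector) \<Rightarrow> bool" where
  "smooth_on S f \<longleftrightarrow> (\<forall>k. Ck_on k S f)"

(* A 1-form is a function of a point and a tangent vector, a 2-form of a point and two
   tangent vectors. *)

definition diff_form :: "('a::real_normed_vector \<Rightarrow> 'b::real_normed_vector) \<Rightarrow> 'a \<Rightarrow> 'a \<Rightarrow> 'b" where
  "diff_form f x v = frechet_derivative f (at x) v"

(* No factor 1/2 in either operation, so d(f dg) = df \<and> dg and the curvature form of a connection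
   form w is dw + w \<and> w. *)

definition form_wedge :: "('a \<Rightarrow> 'a \<Rightarrow> real) \<Rightarrow> ('a \<Rightarrow> 'a \<Rightarrow> real) \<Rightarrow> 'a \<Rightarrow> 'a \<Rightarrow> 'a \<Rightarrow> real"
  (infixr "\<and>\<^sub>f" 72) where
  "(\<alpha> \<and>\<^sub>f \<beta>) x u v = \<alpha> x u * \<beta> x v - \<alpha> x v * \<beta> x u"

definition ext_d :: "('a::real_normed_vector \<Rightarrow> 'a \<Rightarrow> real) \<Rightarrow> 'a \<Rightarrow> 'a \<Rightarrow> 'a \<Rightarrow> real" where
  "ext_d \<alpha> x u v = diff_form (\<lambda>y. \<alpha> y v) x u - diff_form (\<lambda>y. \<alpha> y u) x v"

definition lie_bracket ::
  "('a::real_normed_vector \<Rightarrow> 'a) \<Rightarrow> ('a \<Rightarrow> 'a) \<Rightarrow> 'a \<Rightarrow> 'a" where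
  "lie_bracket X Y x = diff_form Y x (X x) - diff_form X x (Y x)"

(* Each fibre of a bundle of rank n is, as a vector space only, identified with real^'n; this
   identification is not required to depend on the base point in any regular way.  The smooth
   structure and the orientation come from the atlas alone: an element (U, F) of the atlas is a
   local trivialization over U, whose restriction to the fibre over x is the linear isomorphism
   F x.  The transition functions are smooth with positive determinant.  Since an abstract bundle
   can always be written this way, being isomorphic to a product bundle is not built in. *)

type_synonym ('m, 'n) atlas = "((real^'m) set \<times> (real^'m \<Rightarrow> real^'n^'n)) set"

definition oriented_bundle :: "('m::finite, 'n::finite) atlas \<Rightarrow> bool" where
  "oriented_bundle A \<longleftrightarrow>
     (\<Union>(U, F)\<in>A. U) = UNIV \<and>
     (\<forall>(U, F)\<in>A. open U \<and> (\<forall>x\<in>U. invertible (F x))) \<and>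
     (\<forall>(U, F)\<in>A. \<forall>(V, G)\<in>A.
        smooth_on (U \<inter> V) (\<lambda>x. G x ** matrix_inv (F x)) \<and>
        (\<forall>x\<in>U \<inter> V. det (G x ** matrix_inv (F x)) > 0))"

definition smooth_section :: "('m::finite, 'n::finite) atlas \<Rightarrow> (real^'m \<Rightarrow> real^'n) \<Rightarrow> bool" where
  "smooth_section A s \<longleftrightarrow> (\<forall>(U, F)\<in>A. smooth_on U (\<lambda>x. F x *v s x))"

(* e j is the j-th member of the frame; the matrix has the trivialized frame as columns. *)

definition gives_orientation ::
  "('m::finite, 'n::finite) atlas \<Rightarrow> ('n \<Rightarrow> real^'m \<Rightarrow> real^'n) \<Rightarrow> bool" where
  "gives_orientation A e \<longleftrightarrow> (\<forall>(U, F)\<in>A. \<forall>x\<in>U. det (\<chi> i j. (F x *v e j x) $ i) > 0)"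

(* D s x v is the covariant derivative at x of the section s along the tangent
   vector v.  Only its values on smooth sections are meaningful. *)

type_synonym ('m, 'n) cov_deriv = "(real^'m \<Rightarrow> real^'n) \<Rightarrow> real^'m \<Rightarrow> real^'m \<Rightarrow> real^'n"

definition connection :: "('m::finite, 'n::finite) atlas \<Rightarrow> ('m, 'n) cov_deriv \<Rightarrow> bool" where
  "connection A D \<longleftrightarrow>
     (\<forall>s x. smooth_section A s \<longrightarrow> linear (D s x)) \<and>
     (\<forall>s X. smooth_section A s \<longrightarrow> smooth_on UNIV X \<longrightarrow> smooth_section A (\<lambda>x. D s x (X x))) \<and>
     (\<forall>s t x v. smooth_section A s \<longrightarrow> smooth_section A t \<longrightarrow>
        D (\<lambda>y. s y + t y) x v = D s x v + D t x v) \<and>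
     (\<forall>\<phi> s x v. smooth_on UNIV \<phi> \<longrightarrow> smooth_section A s \<longrightarrow>
        D (\<lambda>y. \<phi> y *\<^sub>R s y) x v = diff_form \<phi> x v *\<^sub>R s x + \<phi> x *\<^sub>R D s x v)"

definition curvature ::
  "('m::finite, 'n::finite) cov_deriv \<Rightarrow> (real^'m \<Rightarrow> real^'m) \<Rightarrow> (real^'m \<Rightarrow> real^'m) \<Rightarrow>
   (real^'m \<Rightarrow> real^'n) \<Rightarrow> real^'m \<Rightarrow> real^'n" where
  "curvature D X Y s x =
     D (\<lambda>y. D s y (Y y)) x (X x) - D (\<lambda>y. D s y (X y)) x (Y x) - D s x (lie_bracket X Y x)"

definition flat :: "('m::finite, 'n::finite) atlas \<Rightarrow> ('m, 'n) cov_deriv \<Rightarrow> bool" where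
  "flat A D \<longleftrightarrow>
     (\<forall>X Y s x. smooth_on UNIV X \<longrightarrow> smooth_on UNIV Y \<longrightarrow> smooth_section A s \<longrightarrow>
        curvature D X Y s x = 0)"

(* D e_j = sum_i e_i w^i_j, with w i j standing for w^i_j (upper index first) *)

definition connection_form ::
  "('m::finite, 'n::finite) cov_deriv \<Rightarrow> ('n \<Rightarrow> real^'m \<Rightarrow> real^'n) \<Rightarrow>
   ('n \<Rightarrow> 'n \<Rightarrow> real^'m \<Rightarrow> real^'m \<Rightarrow> real) \<Rightarrow> bool" where
  "connection_form D e \<omega> \<longleftrightarrow> (\<forall>j x v. D (e j) x v = (\<Sum>i\<in>UNIV. \<omega> i j x v *\<^sub>R e i x))"

(* The indices 1, 2, 3, 4 :: 4 are pairwise distinct (4 = 0 in this type). *)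

definition pseudo_orthonormal ::
  "(real^4 \<Rightarrow> real^4 \<Rightarrow> real) \<Rightarrow> (4 \<Rightarrow> real^4) \<Rightarrow> bool" where
  "pseudo_orthonormal b e \<longleftrightarrow>
     (\<forall>i j. b (e i) (e j) = (if i \<noteq> j then 0 else if i = 1 \<or> i = 2 then 1 else - 1))"

(* Signature (2,2) is expressed by the existence, at each point, of a basis in which the form
   is diag(1,1,-1,-1); linear independence of such vectors is automatic. *)

definition neutral_metric ::
  "('m::finite, 4) atlas \<Rightarrow> (real^'m \<Rightarrow> real^4 \<Rightarrow> real^4 \<Rightarrow> real) \<Rightarrow> bool" where
  "neutral_metric A h \<longleftrightarrow>
     (\<forall>x. bilinear (h x) \<and> (\<forall>u v. h x u v = h x v u) \<and> (\<exists>b. pseudo_orthonormal (h x) b)) \<and>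
     (\<forall>s t. smooth_section A s \<longrightarrow> smooth_section A t \<longrightarrow> smooth_on UNIV (\<lambda>x. h x (s x) (t x)))"

definition metric_connection ::
  "('m::finite, 'n::finite) atlas \<Rightarrow> (real^'m \<Rightarrow> real^'n \<Rightarrow> real^'n \<Rightarrow> real) \<Rightarrow>
   ('m, 'n) cov_deriv \<Rightarrow> bool" where
  "metric_connection A h D \<longleftrightarrow> connection A D \<and>
     (\<forall>s t x v. smooth_section A s \<longrightarrow> smooth_section A t \<longrightarrow>
        diff_form (\<lambda>y. h y (s y) (t y)) x v = h x (D s x v) (t x) + h x (s x) (D t x v))"

definition pseudo_orthonormal_frame ::
  "('m::finite, 4) atlas \<Rightarrow> (real^'m \<Rightarrow> real^4 \<Rightarrow> real^4 \<Rightarrow> real) \<Rightarrow>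
   (4 \<Rightarrow> real^'m \<Rightarrow> real^4) \<Rightarrow> bool" where
  "pseudo_orthonormal_frame A h e \<longleftrightarrow>
     (\<forall>i. smooth_section A (e i)) \<and> (\<forall>x. pseudo_orthonormal (h x) (\<lambda>i. e i x))"

(* The exterior square of a fibre is modelled by the skew-symmetric matrices in real^'n^'n. *)

definition bivec :: "real^'n \<Rightarrow> real^'n \<Rightarrow> real^'n^'n" (infixr "\<and>\<^sub>b" 72) where
  "u \<and>\<^sub>b v = (\<chi> i j. u $ i * v $ j - v $ i * u $ j)"

(* Characterized by its values on decomposable bivectors, see lemma hat_metric_bivec.  The
   division by 2 makes that value the plain determinant. *)

definition hat_metric ::
  "(real^'n \<Rightarrow> real^'n \<Rightarrow> real) \<Rightarrow> real^'n^'n \<Rightarrow> real^'n^'n \<Rightarrow> real" where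
  "hat_metric b \<theta> \<eta> =
     (\<Sum>i\<in>UNIV. \<Sum>j\<in>UNIV. \<Sum>k\<in>UNIV. \<Sum>l\<in>UNIV.
        b (axis i 1) (axis k 1) * b (axis j 1) (axis l 1) * \<theta> $ i $ j * \<eta> $ k $ l) / 2"

lemma hat_metric_bivec:
  fixes u v w z :: "real^'n::finite"
  assumes "bilinear b"
  shows "hat_metric b (u \<and>\<^sub>b v) (w \<and>\<^sub>b z) = b u w * b v z - b u z * b v w"
proof -
  define H where "H i k = b (axis i 1) (axis k 1)" for i k
  have ex: "b p q = (\<Sum>i\<in>UNIV. \<Sum>k\<in>UNIV. H i k * (p $ i * q $ k))" for p q :: "real^'n"
  proof -
    have "b p q = b (\<Sum>i\<in>UNIV. p $ i *\<^sub>R axis i 1) (\<Sum>k\<in>UNIV. q $ k *\<^sub>R axis k 1)"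
      using basis_expansion[of p] basis_expansion[of q]
      by (simp only: scalar_mult_eq_scaleR)
    also have "\<dots> = (\<Sum>(i, k)\<in>UNIV \<times> UNIV. b (p $ i *\<^sub>R axis i 1) (q $ k *\<^sub>R axis k 1))"
      by (rule bilinear_sum[OF assms])
    also have "\<dots> = (\<Sum>i\<in>UNIV. \<Sum>k\<in>UNIV. b (p $ i *\<^sub>R axis i 1) (q $ k *\<^sub>R axis k 1))"
      by (rule sum.cartesian_product[symmetric])
    also have "\<dots> = (\<Sum>i\<in>UNIV. \<Sum>k\<in>UNIV. H i k * (p $ i * q $ k))"
      by (intro sum.cong refl) (simp add: H_def bilinear_lmul[OF assms] bilinear_rmul[OF assms])
    finally show ?thesis .
  qed
  have pr: "b p q * b p' q' =
      (\<Sum>i\<in>UNIV. \<Sum>j\<in>UNIV. \<Sum>k\<in>UNIV. \<Sum>l\<in>UNIV.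
         H i k * H j l * (p $ i * p' $ j * q $ k * q' $ l))" for p q p' q' :: "real^'n"
  proof -
    have "b p q * b p' q' = (\<Sum>i\<in>UNIV. \<Sum>j\<in>UNIV.
        (\<Sum>k\<in>UNIV. H i k * (p $ i * q $ k)) * (\<Sum>l\<in>UNIV. H j l * (p' $ j * q' $ l)))"
      unfolding ex[of p q] ex[of p' q'] by (rule sum_product)
    also have "\<dots> = (\<Sum>i\<in>UNIV. \<Sum>j\<in>UNIV. \<Sum>k\<in>UNIV. \<Sum>l\<in>UNIV.
        (H i k * (p $ i * q $ k)) * (H j l * (p' $ j * q' $ l)))"
      by (intro sum.cong refl) (rule sum_product)
    finally show ?thesis by (simp only: mult_ac)
  qed
  have "2 * hat_metric b (u \<and>\<^sub>b v) (w \<and>\<^sub>b z) =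
      (\<Sum>i\<in>UNIV. \<Sum>j\<in>UNIV. \<Sum>k\<in>UNIV. \<Sum>l\<in>UNIV. H i k * H j l *
         ((u $ i * v $ j - v $ i * u $ j) * (w $ k * z $ l - z $ k * w $ l)))"
    by (simp add: hat_metric_def H_def bivec_def mult.assoc)
  also have "\<dots> = b u w * b v z - b u z * b v w - b v w * b u z + b v z * b u w"
    unfolding pr sum.distrib[symmetric] sum_subtractf[symmetric]
    by (intro sum.cong refl) (simp add: algebra_simps)
  finally show ?thesis by (simp add: mult.commute)
qed

(* A smooth bivector field is locally a finite sum of
   products of smooth sections, and its derivative is given by the product rule.  The value does
   not depend on the representation. *)

definition hat_D ::
  "('m::finite, 'n::finite) atlas \<Rightarrow> ('m, 'n) cov_deriv \<Rightarrow> (real^'m \<Rightarrow> real^'n^'n) \<Rightarrow>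
   real^'m \<Rightarrow> real^'m \<Rightarrow> real^'n^'n" where
  "hat_D A D \<Theta> x v = (THE w. \<exists>N::nat. \<exists>s t U.
     open U \<and> x \<in> U \<and>
     (\<forall>k<N. smooth_section A (s k) \<and> smooth_section A (t k)) \<and>
     (\<forall>y\<in>U. \<Theta> y = (\<Sum>k<N. s k y \<and>\<^sub>b t k y)) \<and>
     w = (\<Sum>k<N. D (s k) x v \<and>\<^sub>b t k x + s k x \<and>\<^sub>b D (t k) x v))"

(* Signs are the real numbers 1 and -1. *)

definition Omega1 :: "real \<Rightarrow> (4 \<Rightarrow> real^'m \<Rightarrow> real^4) \<Rightarrow> real^'m \<Rightarrow> real^4^4" where
  "Omega1 \<epsilon> e x = (1 / sqrt 2) *\<^sub>R (e 1 x \<and>\<^sub>b e 2 x + \<epsilon> *\<^sub>R (e 3 x \<and>\<^sub>b e 4 x))"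

definition Omega2 :: "real \<Rightarrow> (4 \<Rightarrow> real^'m \<Rightarrow> real^4) \<Rightarrow> real^'m \<Rightarrow> real^4^4" where
  "Omega2 \<epsilon> e x = (1 / sqrt 2) *\<^sub>R (e 1 x \<and>\<^sub>b e 3 x + \<epsilon> *\<^sub>R (e 4 x \<and>\<^sub>b e 2 x))"

definition Omega3 :: "real \<Rightarrow> (4 \<Rightarrow> real^'m \<Rightarrow> real^4) \<Rightarrow> real^'m \<Rightarrow> real^4^4" where
  "Omega3 \<epsilon> e x = (1 / sqrt 2) *\<^sub>R (e 1 x \<and>\<^sub>b e 4 x + \<epsilon> *\<^sub>R (e 2 x \<and>\<^sub>b e 3 x))"

definition Omega0 :: "real \<Rightarrow> real \<Rightarrow> (4 \<Rightarrow> real^'m \<Rightarrow> real^4) \<Rightarrow> real^'m \<Rightarrow> real^4^4" where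
  "Omega0 \<epsilon> \<mu> e x = Omega1 (- \<epsilon>) e x + \<mu> *\<^sub>R Omega3 \<epsilon> e x"

definition light_like :: "(real^4 \<Rightarrow> real^4 \<Rightarrow> real) \<Rightarrow> real^4^4 \<Rightarrow> bool" where
  "light_like b \<theta> \<longleftrightarrow> \<theta> \<noteq> 0 \<and> hat_metric b \<theta> \<theta> = 0"

definition fully_light_like ::
  "('m::finite, 4) atlas \<Rightarrow> (real^'m \<Rightarrow> real^4 \<Rightarrow> real^4 \<Rightarrow> real) \<Rightarrow> ('m, 4) cov_deriv \<Rightarrow>
   (real^'m \<Rightarrow> real^4^4) \<Rightarrow> bool" where
  "fully_light_like A h D \<Theta> \<longleftrightarrow>
     (\<forall>p. (\<forall>v. light_like (h p) (hat_D A D \<Theta> p v) \<or> hat_D A D \<Theta> p v = 0) \<and>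
          (\<exists>v. hat_D A D \<Theta> p v \<noteq> 0))"

definition structure_equations ::
  "real \<Rightarrow> real \<Rightarrow> (real^'m::finite \<Rightarrow> real) \<Rightarrow> (real^'m \<Rightarrow> real) \<Rightarrow>
   (4 \<Rightarrow> 4 \<Rightarrow> real^'m \<Rightarrow> real^'m \<Rightarrow> real) \<Rightarrow> bool" where
  "structure_equations \<epsilon> \<mu> f g \<omega> \<longleftrightarrow>
     smooth_on UNIV f \<and> smooth_on UNIV g \<and>
     (\<forall>x. \<exists>v. diff_form g x v \<noteq> 0) \<and>
     (\<forall>x v. \<omega> 4 1 x v = \<epsilon> * exp (\<mu> * f x) * diff_form g x v - \<epsilon> * \<omega> 3 2 x v) \<and>
     (\<forall>x v. \<omega> 4 2 x v = \<epsilon> * \<omega> 3 1 x v - diff_form f x v) \<and>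
     (\<forall>x v. \<omega> 4 3 x v = \<mu> * exp (\<mu> * f x) * diff_form g x v - \<epsilon> * \<omega> 2 1 x v) \<and>
     (\<forall>x u v. ext_d (\<omega> 2 1) x u v =
        2 * (\<omega> 3 1 \<and>\<^sub>f \<omega> 3 2) x u v
        - exp (\<mu> * f x) * (\<omega> 3 1 \<and>\<^sub>f diff_form g) x u v
        + \<epsilon> * (\<omega> 3 2 \<and>\<^sub>f diff_form f) x u v
        + \<epsilon> * exp (\<mu> * f x) * (diff_form f \<and>\<^sub>f diff_form g) x u v) \<and>
     (\<forall>x u v. ext_d (\<omega> 3 1) x u v =
        2 * (\<omega> 2 1 \<and>\<^sub>f \<omega> 3 2) x u v
        - exp (\<mu> * f x) * (\<omega> 2 1 \<and>\<^sub>f diff_form g) x u v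
        + \<epsilon> * \<mu> * exp (\<mu> * f x) * (\<omega> 3 2 \<and>\<^sub>f diff_form g) x u v) \<and>
     (\<forall>x u v. ext_d (\<omega> 3 2) x u v =
        - 2 * (\<omega> 2 1 \<and>\<^sub>f \<omega> 3 1) x u v
        + \<epsilon> * (\<omega> 2 1 \<and>\<^sub>f diff_form f) x u v
        - \<epsilon> * \<mu> * exp (\<mu> * f x) * (\<omega> 3 1 \<and>\<^sub>f diff_form g) x u v
        + \<mu> * exp (\<mu> * f x) * (diff_form f \<and>\<^sub>f diff_form g) x u v)"

end

(*
  With respect to e the covariant derivative acts on the rank 3 bundle by
    D Omega_{eps,2} = alpha Omega_{-eps,1} + beta Omega_{eps,3},
    D Omega_{-eps,1} = alpha Omega_{eps,2} + gamma Omega_{eps,3},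
    D Omega_{eps,3} = gamma Omega_{-eps,1} - beta Omega_{eps,2}
  for three 1-forms, and flatness says d alpha = beta wedge gamma and d gamma = alpha wedge beta.
  Being fully light-like means alpha^2 = beta^2 with alpha nowhere zero, hence beta = mu alpha with
  a constant sign mu by connectedness.  Then gamma is closed, gamma = - df by the Poincare lemma,
  exp(- mu f) alpha is closed too, hence equal to some dg.  Conversely alpha, beta and gamma encode
  the first three equations of (b), and the remaining three are then the structure equations of a
  flat connection.  Finally D Omega_0 = - mu df Omega_0, and a boost by f in the (e_2, e_4)-plane
  fixes Omega_{eps,2} and multiplies Omega_0 by exp(mu f), which makes it horizontal.
*)
theory Submission
  imports Defs
begin

section \<open>Smooth functions\<close>

lemma diff_form_eqI: "(f has_derivative f') (at x) \<Longrightarrow> diff_form f x = f'"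
  by (rule ext) (simp add: diff_form_def frechet_derivative_at[symmetric])

lemma has_derivative_diff_form: "f differentiable (at x) \<Longrightarrow> (f has_derivative diff_form f x) (at x)"
  by (simp add: frechet_derivative_works diff_form_def[abs_def])

lemma diff_form_const [simp]: "diff_form (\<lambda>y. c) x v = 0"
  by (simp add: diff_form_eqI[OF has_derivative_const])

text \<open>The form of the recursion used from here on: stated through \<open>diff_form\<close>, it
  accepts derivatives computed by \<open>diff_form_eqI\<close>.\<close>

lemma Ck_on_Suc_diff_form:
  "Ck_on (Suc k) S f \<longleftrightarrow> (\<forall>x\<in>S. f differentiable (at x)) \<and> (\<forall>v. Ck_on k S (\<lambda>x. diff_form f x v))"
  by (simp add: diff_form_def)

declare Ck_on.simps(2) [simp del]

text \<open>Openness turns agreement on S into agreement near each point, so the derivatives agree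
  as well and the induction can pass to them.\<close>

lemma Ck_on_cong:
  assumes "open S" "\<And>x. x \<in> S \<Longrightarrow> f x = g x" "Ck_on k S f"
  shows "Ck_on k S g"
  using assms(2,3)
proof (induction k arbitrary: f g)
  case 0
  then show ?case using continuous_on_cong[of S S f g] by simp
next
  case (Suc k)
  have diff: "f differentiable (at x)" if "x \<in> S" for x
    using Suc.prems(2) that unfolding Ck_on_Suc_diff_form by blast
  have d: "(g has_derivative diff_form f x) (at x)" if "x \<in> S" for x
    using has_derivative_transform_within_open[OF has_derivative_diff_form[OF diff[OF that]] assms(1) that]
      Suc.prems(1) by blast
  have eq: "diff_form g x = diff_form f x" if "x \<in> S" for x
    using d[OF that] by (rule diff_form_eqI)
  have "Ck_on k S (\<lambda>x. diff_form g x v)" for v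
  proof (rule Suc.IH)
    show "Ck_on k S (\<lambda>x. diff_form f x v)"
      using Suc.prems(2) unfolding Ck_on_Suc_diff_form by blast
  qed (simp add: eq)
  then show ?case
    using d unfolding Ck_on_Suc_diff_form differentiable_def by blast
qed

lemma Ck_on_Suc_has_derivative:
  "Ck_on (Suc k) S f \<Longrightarrow> x \<in> S \<Longrightarrow> (f has_derivative diff_form f x) (at x)"
  unfolding Ck_on_Suc_diff_form by (blast intro: has_derivative_diff_form)

lemma Ck_on_diff_form: "Ck_on (Suc k) S f \<Longrightarrow> Ck_on k S (\<lambda>x. diff_form f x v)"
  unfolding Ck_on_Suc_diff_form by blast

text \<open>Closure proofs below run through this rule: it suffices to exhibit some derivative on S
  whose directional values are of class C^k.\<close>

lemma Ck_on_SucI: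
  assumes "open S" "\<And>x. x \<in> S \<Longrightarrow> (f has_derivative f' x) (at x)" "\<And>v. Ck_on k S (\<lambda>x. f' x v)"
  shows "Ck_on (Suc k) S f"
  unfolding Ck_on_Suc_diff_form
proof (intro conjI ballI allI)
  show "f differentiable (at x)" if "x \<in> S" for x
    using assms(2)[OF that] unfolding differentiable_def by blast
  show "Ck_on k S (\<lambda>x. diff_form f x v)" for v
    using assms(1) _ assms(3)[of v] by (rule Ck_on_cong) (simp add: diff_form_eqI[OF assms(2)])
qed

lemma Ck_on_Suc_imp: "Ck_on (Suc k) S f \<Longrightarrow> Ck_on k S f"
proof (induction k arbitrary: f)
  case 0
  have "continuous (at x within S) f" if "x \<in> S" for x
    by (rule continuous_at_imp_continuous_within
        [OF has_derivative_continuous[OF Ck_on_Suc_has_derivative[OF 0 that]]])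
  then show ?case
    by (simp add: continuous_on_eq_continuous_within)
next
  case (Suc k)
  show ?case
    unfolding Ck_on_Suc_diff_form[of k]
    using Suc.IH[OF Ck_on_diff_form[OF Suc.prems]] Ck_on_Suc_has_derivative[OF Suc.prems]
    by (blast intro: differentiableI)
qed

lemma Ck_on_subset: "Ck_on k S f \<Longrightarrow> T \<subseteq> S \<Longrightarrow> Ck_on k T f"
proof (induction k arbitrary: f)
  case 0
  then show ?case by (auto intro: continuous_on_subset)
next
  case (Suc k)
  then show ?case unfolding Ck_on_Suc_diff_form by blast
qed

lemma Ck_on_const: "Ck_on k S (\<lambda>x. c)"
  by (induction k arbitrary: c) (simp_all add: Ck_on_Suc_diff_form)

lemma Ck_on_add:
  assumes "open S" "Ck_on k S f" "Ck_on k S g"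
  shows "Ck_on k S (\<lambda>x. f x + g x)"
  using assms(2,3)
proof (induction k arbitrary: f g)
  case 0
  then show ?case by (auto intro: continuous_on_add)
next
  case (Suc k)
  show ?case
    by (rule Ck_on_SucI[OF assms(1)
          has_derivative_add[OF Ck_on_Suc_has_derivative[OF Suc.prems(1)]
            Ck_on_Suc_has_derivative[OF Suc.prems(2)]]
          Suc.IH[OF Ck_on_diff_form[OF Suc.prems(1)] Ck_on_diff_form[OF Suc.prems(2)]]])
qed

lemma Ck_on_scaleR:
  fixes \<phi> :: "'a::real_normed_vector \<Rightarrow> real"
  assumes "open S" "Ck_on k S \<phi>" "Ck_on k S g"
  shows "Ck_on k S (\<lambda>x. \<phi> x *\<^sub>R g x)"
  using assms(2,3)
proof (induction k arbitrary: \<phi> g)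
  case 0
  then show ?case by (auto intro: continuous_on_scaleR)
next
  case (Suc k)
  note d\<phi> = Ck_on_diff_form[OF Suc.prems(1)] and dg = Ck_on_diff_form[OF Suc.prems(2)]
  \<comment> \<open>In each summand of the product rule one factor is a derivative, hence of class
    C^k; the other is lowered from C^(k+1) to C^k by \<open>Ck_on_Suc_imp\<close>.\<close>
  show ?case
    by (rule Ck_on_SucI[OF assms(1)
          has_derivative_scaleR[OF Ck_on_Suc_has_derivative[OF Suc.prems(1)]
            Ck_on_Suc_has_derivative[OF Suc.prems(2)]]
          Ck_on_add[OF assms(1) Suc.IH[OF Ck_on_Suc_imp[OF Suc.prems(1)] dg]
            Suc.IH[OF d\<phi> Ck_on_Suc_imp[OF Suc.prems(2)]]]])
qed

text \<open>The derivative of exp f is exp f times df, so exp f reappears one order lower and the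
  induction closes.\<close>

lemma Ck_on_exp:
  fixes f :: "'a::real_normed_vector \<Rightarrow> real"
  assumes "open S" "Ck_on k S f"
  shows "Ck_on k S (\<lambda>x. exp (f x))"
  using assms(2)
proof (induction k)
  case 0
  then show ?case by (auto intro: continuous_on_exp)
next
  case (Suc k)
  show ?case
  proof (rule Ck_on_SucI[OF assms(1)])
    show "((\<lambda>x. exp (f x)) has_derivative (\<lambda>v. exp (f x) *\<^sub>R diff_form f x v)) (at x)"
      if "x \<in> S" for x
      using has_derivative_exp[OF Ck_on_Suc_has_derivative[OF Suc.prems that]] by (simp add: mult.commute)
    show "Ck_on k S (\<lambda>x. exp (f x) *\<^sub>R diff_form f x v)" for v
      by (rule Ck_on_scaleR[OF assms(1) Suc.IH[OF Ck_on_Suc_imp[OF Suc.prems]]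
            Ck_on_diff_form[OF Suc.prems]])
  qed
qed

section \<open>Closure properties of smooth functions\<close>

lemma smooth_on_subset: "smooth_on S f \<Longrightarrow> T \<subseteq> S \<Longrightarrow> smooth_on T f"
  using Ck_on_subset[of _ S f T] by (auto simp: smooth_on_def)

lemma smooth_on_const: "smooth_on S (\<lambda>x. c)"
  by (simp add: smooth_on_def Ck_on_const)

lemma smooth_on_add:
  "open S \<Longrightarrow> smooth_on S f \<Longrightarrow> smooth_on S g \<Longrightarrow> smooth_on S (\<lambda>x. f x + g x)"
  by (simp add: smooth_on_def Ck_on_add)

lemma smooth_on_scaleR:
  fixes \<phi> :: "'a::real_normed_vector \<Rightarrow> real"
  shows "open S \<Longrightarrow> smooth_on S \<phi> \<Longrightarrow> smooth_on S g \<Longrightarrow> smooth_on S (\<lambda>x. \<phi> x *\<^sub>R g x)"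
  by (simp add: smooth_on_def Ck_on_scaleR)

lemma smooth_on_mult:
  fixes f g :: "'a::real_normed_vector \<Rightarrow> real"
  shows "open S \<Longrightarrow> smooth_on S f \<Longrightarrow> smooth_on S g \<Longrightarrow> smooth_on S (\<lambda>x. f x * g x)"
  using smooth_on_scaleR[of S f g] by simp

lemma smooth_on_diff:
  fixes f g :: "'a::real_normed_vector \<Rightarrow> real"
  shows "open S \<Longrightarrow> smooth_on S f \<Longrightarrow> smooth_on S g \<Longrightarrow> smooth_on S (\<lambda>x. f x - g x)"
  using smooth_on_add[of S f "\<lambda>x. - 1 * g x"]
    smooth_on_mult[OF _ smooth_on_const[of S "- 1"], of g]
  by simp

lemma smooth_on_exp:
  fixes f :: "'a::real_normed_vector \<Rightarrow> real"
  shows "open S \<Longrightarrow> smooth_on S f \<Longrightarrow> smooth_on S (\<lambda>x. exp (f x))"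
  by (simp add: smooth_on_def Ck_on_exp)

lemma smooth_on_cosh_sinh:
  fixes f :: "'a::real_normed_vector \<Rightarrow> real"
  assumes "open S" "smooth_on S f"
  shows "smooth_on S (\<lambda>x. cosh (f x))" "smooth_on S (\<lambda>x. sinh (f x))"
proof -
  have e: "smooth_on S (\<lambda>x. exp (f x))"
    by (intro smooth_on_exp assms)
  have e': "smooth_on S (\<lambda>x. exp (- f x))"
    using smooth_on_exp[OF assms(1) smooth_on_diff[OF assms(1) smooth_on_const[of S 0] assms(2)]] by simp
  show "smooth_on S (\<lambda>x. cosh (f x))"
    using smooth_on_scaleR[OF assms(1) smooth_on_const[of S "1 / 2"] smooth_on_add[OF assms(1) e e']]
    by (simp add: cosh_def)
  show "smooth_on S (\<lambda>x. sinh (f x))"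
    using smooth_on_scaleR[OF assms(1) smooth_on_const[of S "1 / 2"] smooth_on_diff[OF assms(1) e e']]
    by (simp add: sinh_def)
qed

lemma smooth_on_has_derivative:
  "smooth_on S f \<Longrightarrow> x \<in> S \<Longrightarrow> (f has_derivative diff_form f x) (at x)"
  unfolding smooth_on_def using Ck_on_Suc_has_derivative[of 0 S f x] by blast

lemma smooth_on_continuous: "smooth_on S f \<Longrightarrow> continuous_on S f"
  unfolding smooth_on_def using Ck_on.simps(1)[of S f] by blast

lemma smooth_on_diff_form: "smooth_on S f \<Longrightarrow> smooth_on S (\<lambda>x. diff_form f x v)"
  by (simp add: smooth_on_def Ck_on_diff_form)

text \<open>Supplies the smoothness of the potential in the Poincare lemma, where only its
  derivative is known explicitly.\<close>

lemma smooth_on_primitive: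
  assumes "open S" "\<And>x. x \<in> S \<Longrightarrow> (f has_derivative f' x) (at x)" "\<And>v. smooth_on S (\<lambda>x. f' x v)"
  shows "smooth_on S f"
  unfolding smooth_on_def
proof
  \<comment> \<open>Proving C^(k+1) and weakening it to C^k treats all k alike, including k =
    0.\<close>
  show "Ck_on k S f" for k
    by (rule Ck_on_Suc_imp[OF Ck_on_SucI[OF assms(1,2)]])
      (use assms(3) in \<open>simp_all add: smooth_on_def\<close>)
qed

section \<open>The Poincare lemma\<close>

text \<open>The primitive is the integral of \<alpha> along the segment from 0 to x. It is
  differentiated under the integral sign, and closedness makes the new integrand a total derivative
  in t.\<close>

lemma closed_form_exact:
  fixes \<alpha> :: "'a::euclidean_space \<Rightarrow> 'a \<Rightarrow> real"
  assumes lin: "\<And>x. linear (\<alpha> x)"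
    and sm: "\<And>v. smooth_on UNIV (\<lambda>x. \<alpha> x v)"
    and closed: "\<And>x u v. ext_d \<alpha> x u v = 0"
  obtains f where "smooth_on UNIV f" "\<And>x. diff_form f x = \<alpha> x"
proof -
  \<comment> \<open>\<open>a x\<close> represents the form at x through the inner product, so that
    chain rule and integration apply to a single vector-valued map; \<open>da\<close> is its
    derivative.\<close>
  define a where "a x = (\<Sum>b\<in>Basis. \<alpha> x b *\<^sub>R b)" for x
  define da where "da x u = (\<Sum>b\<in>Basis. diff_form (\<lambda>y. \<alpha> y b) x u *\<^sub>R b)" for x u
  have a_inner: "a x \<bullet> v = \<alpha> x v" for x v
  proof -
    have "\<alpha> x v = \<alpha> x (\<Sum>b\<in>Basis. (v \<bullet> b) *\<^sub>R b)"
      by (simp add: euclidean_representation)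
    also have "\<dots> = (\<Sum>b\<in>Basis. (v \<bullet> b) * \<alpha> x b)"
      using lin[of x] by (simp add: linear_sum linear_cmul)
    finally show ?thesis
      by (simp add: a_def inner_sum_left inner_commute[of v] mult.commute)
  qed
  have da: "(a has_derivative da x) (at x)" for x
    unfolding a_def da_def
    by (intro has_derivative_sum has_derivative_scaleR_left smooth_on_has_derivative[OF sm] UNIV_I)
  have a_v: "((\<lambda>y. \<alpha> y v) has_derivative (\<lambda>u. da x u \<bullet> v)) (at x)" for x v
    using has_derivative_inner_left[OF da[of x], of v] by (simp add: a_inner)
  \<comment> \<open>Closedness is the symmetry of the Jacobian of \<open>a\<close>.\<close>
  have sym: "da x u \<bullet> v = da x v \<bullet> u" for x u v
    using closed[of x u v] by (simp add: ext_d_def diff_form_eqI[OF a_v])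
  have da_lin: "linear (da x)" for x
    using da by (rule has_derivative_linear)
  \<comment> \<open>Continuity of \<open>da\<close> in the base point is at hand for fixed
    directions; expanding the direction in the basis yields the joint continuity behind
    \<open>cont_W\<close>.\<close>
  have da_expand: "da x w = (\<Sum>b\<in>Basis. (w \<bullet> b) *\<^sub>R da x b)" for x w
  proof -
    have "da x w = da x (\<Sum>b\<in>Basis. (w \<bullet> b) *\<^sub>R b)"
      by (simp add: euclidean_representation)
    then show ?thesis
      using da_lin[of x] by (simp add: linear_sum linear_cmul)
  qed
  have cont_da_b: "continuous_on UNIV (\<lambda>x. da x b)" for b
    unfolding da_def
    by (intro continuous_intros smooth_on_continuous smooth_on_diff_form sm)
  have cont_a: "continuous_on UNIV a"
    unfolding a_def by (intro continuous_intros smooth_on_continuous sm)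
  \<comment> \<open>By closedness, \<open>W x t\<close> is both the gradient of \<open>a (t x) \<bullet> x\<close> in \<open>x\<close> and the derivative of \<open>t a (t x)\<close> in \<open>t\<close>.\<close>
  define W where "W x t = a (t *\<^sub>R x) + t *\<^sub>R da (t *\<^sub>R x) x" for x :: 'a and t :: real
  have cont_W: "continuous_on UNIV (\<lambda>(x, t). W x t)"
    unfolding W_def split_def
    by (subst da_expand)
      (intro continuous_intros continuous_on_compose2[OF cont_a] continuous_on_compose2[OF cont_da_b]; simp)
  define f where "f x = integral {0..1} (\<lambda>t. a (t *\<^sub>R x) \<bullet> x)" for x
  have "(f has_derivative \<alpha> x) (at x)" for x
  proof -
    \<comment> \<open>\<open>leibniz_rule\<close> asks for a derivative that is continuous as a map
      into the bounded linear functionals, hence \<open>blinfun_inner_left (W x t)\<close>.\<close>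
    have "((\<lambda>x. integral (cbox 0 1) (\<lambda>t. a (t *\<^sub>R x) \<bullet> x)) has_derivative
        blinfun_apply (integral (cbox 0 1) (\<lambda>t. blinfun_inner_left (W x t)))) (at x within UNIV)"
    proof (rule leibniz_rule)
      fix x and t :: real
      show "((\<lambda>x. a (t *\<^sub>R x) \<bullet> x) has_derivative blinfun_apply (blinfun_inner_left (W x t)))
          (at x within UNIV)"
      proof -
        have "((\<lambda>x. a (t *\<^sub>R x)) has_derivative (\<lambda>u. da (t *\<^sub>R x) (t *\<^sub>R u))) (at x)"
          by (rule has_derivative_compose[OF _ da, of "\<lambda>x. t *\<^sub>R x"]) (auto intro!: derivative_eq_intros)
        then have "((\<lambda>x. a (t *\<^sub>R x) \<bullet> x) has_derivative
            (\<lambda>u. a (t *\<^sub>R x) \<bullet> u + da (t *\<^sub>R x) (t *\<^sub>R u) \<bullet> x)) (at x)"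
          by (intro has_derivative_inner) auto
        moreover have "a (t *\<^sub>R x) \<bullet> u + da (t *\<^sub>R x) (t *\<^sub>R u) \<bullet> x = W x t \<bullet> u" for u
          using da_lin[of "t *\<^sub>R x"] sym[of "t *\<^sub>R x" u x]
          by (simp add: W_def inner_add_left linear_cmul)
        ultimately show ?thesis
          by (simp add: inner_commute)
      qed
    next
      fix x
      show "(\<lambda>t. a (t *\<^sub>R x) \<bullet> x) integrable_on cbox 0 (1::real)"
        by (intro integrable_continuous continuous_intros continuous_on_compose2[OF cont_a]) simp
    next
      show "continuous_on (UNIV \<times> cbox 0 1) (\<lambda>(x, t). blinfun_inner_left (W x t))"
        using bounded_linear.continuous_on[OF bounded_linear_blinfun_inner_left
            continuous_on_subset[OF cont_W subset_UNIV]]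
        by (simp add: split_def)
    qed auto
    moreover have "blinfun_apply (integral (cbox 0 1) (\<lambda>t. blinfun_inner_left (W x t))) = \<alpha> x"
    proof
      fix v
      \<comment> \<open>\<open>W x\<close> is the derivative of t times a(t x), which equals
        \<open>a x\<close> at t = 1 and 0 at t = 0.\<close>
      have "(W x has_integral 1 *\<^sub>R a (1 *\<^sub>R x) - 0 *\<^sub>R a (0 *\<^sub>R x)) {0..1}"
      proof (rule fundamental_theorem_of_calculus)
        fix t :: real
        have "((\<lambda>t. a (t *\<^sub>R x)) has_derivative (\<lambda>s. da (t *\<^sub>R x) (s *\<^sub>R x))) (at t)"
          by (rule has_derivative_compose[OF _ da, of "\<lambda>t. t *\<^sub>R x"]) (auto intro!: derivative_eq_intros)
        then have "((\<lambda>t. t *\<^sub>R a (t *\<^sub>R x)) has_derivative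
            (\<lambda>s. t *\<^sub>R da (t *\<^sub>R x) (s *\<^sub>R x) + s *\<^sub>R a (t *\<^sub>R x))) (at t)"
          by (intro has_derivative_scaleR) auto
        then have "((\<lambda>t. t *\<^sub>R a (t *\<^sub>R x)) has_vector_derivative W x t) (at t)"
          unfolding has_vector_derivative_def W_def
          using da_lin[of "t *\<^sub>R x"] by (simp add: linear_cmul algebra_simps)
        then show "((\<lambda>t. t *\<^sub>R a (t *\<^sub>R x)) has_vector_derivative W x t) (at t within {0..1})"
          by (rule has_vector_derivative_at_within)
      qed simp
      from has_integral_linear[OF this bounded_linear_blinfun_inner_left]
      have "integral {0..1} (\<lambda>t. blinfun_inner_left (W x t)) = blinfun_inner_left (a x)"
        by (simp add: o_def integral_unique)
      then show "blinfun_apply (integral (cbox 0 1) (\<lambda>t. blinfun_inner_left (W x t))) v = \<alpha> x v"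
        by (simp add: inner_commute[of v] a_inner)
    qed
    ultimately show ?thesis
      by (simp add: f_def[abs_def])
  qed
  note f_deriv = this
  show ?thesis
    using that smooth_on_primitive[OF open_UNIV f_deriv sm] diff_form_eqI[OF f_deriv] by blast
qed

section \<open>Bivectors and the induced connection\<close>

lemma bivec_add_left: "(u + u') \<and>\<^sub>b v = u \<and>\<^sub>b v + u' \<and>\<^sub>b v"
  and bivec_scaleR_left: "(c *\<^sub>R u) \<and>\<^sub>b v = c *\<^sub>R (u \<and>\<^sub>b v)"
  and bivec_scaleR_right: "u \<and>\<^sub>b (c *\<^sub>R v) = c *\<^sub>R (u \<and>\<^sub>b v)"
  and bivec_swap: "u \<and>\<^sub>b v = - (v \<and>\<^sub>b u)"
  by (simp_all add: bivec_def vec_eq_iff algebra_simps)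

lemma bivec_sum_left: "(\<Sum>i\<in>I. f i) \<and>\<^sub>b v = (\<Sum>i\<in>I. f i \<and>\<^sub>b v)"
  and bivec_sum_right: "v \<and>\<^sub>b (\<Sum>i\<in>I. f i) = (\<Sum>i\<in>I. v \<and>\<^sub>b f i)"
  by (simp_all add: bivec_def vec_eq_iff sum_distrib_left sum_distrib_right sum_subtractf)

lemma hat_metric_add_left: "hat_metric b (\<theta> + \<theta>') \<eta> = hat_metric b \<theta> \<eta> + hat_metric b \<theta>' \<eta>"
  and hat_metric_add_right: "hat_metric b \<eta> (\<theta> + \<theta>') = hat_metric b \<eta> \<theta> + hat_metric b \<eta> \<theta>'"
  by (simp_all add: hat_metric_def algebra_simps sum.distrib add_divide_distrib)

lemma hat_metric_scaleR_left: "hat_metric b (c *\<^sub>R \<theta>) \<eta> = c * hat_metric b \<theta> \<eta>"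
  and hat_metric_scaleR_right: "hat_metric b \<eta> (c *\<^sub>R \<theta>) = c * hat_metric b \<eta> \<theta>"
  by (simp_all add: hat_metric_def sum_distrib_left mult_ac)

lemma hat_metric_zero_left [simp]: "hat_metric b 0 \<eta> = 0"
  by (simp add: hat_metric_def)

lemma hat_metric_sum_left: "hat_metric b (\<Sum>k\<in>I. \<theta> k) \<eta> = (\<Sum>k\<in>I. hat_metric b (\<theta> k) \<eta>)"
  by (induction I rule: infinite_finite_induct) (simp_all add: hat_metric_add_left)

text \<open>The diagonal of the metric in a pseudo-orthonormal frame. Its entries are their own
  inverses, so they also serve to raise an index.\<close>

definition sig :: "4 \<Rightarrow> real" where
  "sig i = (if i = 1 \<or> i = 2 then 1 else - 1)"

lemma sig_simps [simp]: "sig 1 = 1" "sig 2 = 1" "sig 3 = - 1" "sig 4 = - 1"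
  by (simp_all add: sig_def)

lemma sig_mult_self [simp]: "sig i * sig i = 1"
  by (simp add: sig_def)

lemma sig_nonzero [simp]: "sig i \<noteq> 0"
  by (simp add: sig_def)

lemma pseudo_orthonormal_inner:
  "pseudo_orthonormal b f \<Longrightarrow> b (f i) (f j) = (if i = j then sig i else 0)"
  by (simp add: pseudo_orthonormal_def sig_def)

lemma pseudo_orthonormal_coefficient:
  assumes "bilinear b" "pseudo_orthonormal b f"
  shows "b (\<Sum>k\<in>UNIV. c k *\<^sub>R f k) (f i) = sig i * c i"
proof -
  have "b (\<Sum>k\<in>UNIV. c k *\<^sub>R f k) (f i) = (\<Sum>k\<in>UNIV. c k * b (f k) (f i))"
  proof -
    have "linear (\<lambda>u. b u (f i))"
      using assms(1) by (simp add: bilinear_def)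
    then show ?thesis
      by (simp add: linear_sum[of "\<lambda>u. b u (f i)"] linear_cmul[of "\<lambda>u. b u (f i)"])
  qed
  also have "\<dots> = sig i * c i"
    by (simp add: pseudo_orthonormal_inner[OF assms(2)] if_distrib cong: if_cong)
  finally show ?thesis .
qed

text \<open>The form recovers the coefficients of a combination of the frame, so the coordinate map
  \<open>T\<close> is injective, and on a space of dimension 4 it is then onto.\<close>

lemma pseudo_orthonormal_expansion:
  assumes "bilinear b" "pseudo_orthonormal b f"
  shows "v = (\<Sum>i\<in>UNIV. (sig i * b v (f i)) *\<^sub>R f i)"
proof -
  define T :: "real^4 \<Rightarrow> real^4" where "T c = (\<Sum>i\<in>UNIV. c $ i *\<^sub>R f i)" for c
  have lin: "linear T"
    by (rule linearI) (simp_all add: T_def scaleR_left_distrib sum.distrib scaleR_sum_right)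
  have coeff: "b (T c) (f i) = sig i * c $ i" for c i
    unfolding T_def by (rule pseudo_orthonormal_coefficient[OF assms])
  have "inj T"
  proof (rule injI)
    fix c d
    assume "T c = T d"
    then have "sig i * c $ i = sig i * d $ i" for i
      using coeff[of c i] coeff[of d i] by simp
    then show "c = d"
      by (simp add: vec_eq_iff)
  qed
  then obtain c where "v = T c"
    using linear_injective_imp_surjective[OF lin] by (meson surjD)
  then have "sig i * b v (f i) = c $ i" for i
    by (simp add: coeff mult.assoc[symmetric])
  then show ?thesis
    using \<open>v = T c\<close> by (simp add: T_def)
qed

text \<open>The sum runs over ordered pairs and meets each basis bivector twice, whence the factor
  1/2.\<close>

lemma bivec_expansion:
  fixes u v :: "real^4"
  assumes "bilinear b" "pseudo_orthonormal b f"
  shows "u \<and>\<^sub>b v = (1 / 2) *\<^sub>R (\<Sum>i\<in>UNIV. \<Sum>j\<in>UNIV.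
    (sig i * sig j * hat_metric b (u \<and>\<^sub>b v) (f i \<and>\<^sub>b f j)) *\<^sub>R (f i \<and>\<^sub>b f j))"
proof -
  let ?a = "\<lambda>i j. sig i * b u (f i) * (sig j * b v (f j))"
  have 1: "u \<and>\<^sub>b v = (\<Sum>i\<in>UNIV. \<Sum>j\<in>UNIV. ?a i j *\<^sub>R (f i \<and>\<^sub>b f j))"
  proof -
    have v: "z \<and>\<^sub>b v = (\<Sum>j\<in>UNIV. (sig j * b v (f j)) *\<^sub>R (z \<and>\<^sub>b f j))" for z
      by (subst (1) pseudo_orthonormal_expansion[OF assms, of v])
        (simp only: bivec_sum_right bivec_scaleR_right)
    have "u \<and>\<^sub>b v = (\<Sum>i\<in>UNIV. (sig i * b u (f i)) *\<^sub>R (f i \<and>\<^sub>b v))"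
      by (subst (1) pseudo_orthonormal_expansion[OF assms, of u])
        (simp only: bivec_sum_left bivec_scaleR_left)
    then show ?thesis
      by (simp only: v scaleR_sum_right scaleR_scaleR)
  qed
  \<comment> \<open>Exchanging the indices gives a second expansion with transposed and negated
    coefficients. Adding both makes each coefficient the 2 by 2 determinant of
    \<open>hat_metric_bivec\<close>.\<close>
  also have "\<dots> = (\<Sum>i\<in>UNIV. \<Sum>j\<in>UNIV. ?a j i *\<^sub>R (f j \<and>\<^sub>b f i))"
    by (rule sum.swap)
  also have "\<dots> = (\<Sum>i\<in>UNIV. \<Sum>j\<in>UNIV. - ?a j i *\<^sub>R (f i \<and>\<^sub>b f j))"
    by (intro sum.cong refl, subst bivec_swap) simp
  finally have 2: "u \<and>\<^sub>b v = (\<Sum>i\<in>UNIV. \<Sum>j\<in>UNIV. - ?a j i *\<^sub>R (f i \<and>\<^sub>b f j))" .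
  have "2 *\<^sub>R (u \<and>\<^sub>b v) = u \<and>\<^sub>b v + u \<and>\<^sub>b v"
    by (rule scaleR_2)
  also have "\<dots> = (\<Sum>i\<in>UNIV. \<Sum>j\<in>UNIV. ?a i j *\<^sub>R (f i \<and>\<^sub>b f j)) +
      (\<Sum>i\<in>UNIV. \<Sum>j\<in>UNIV. - ?a j i *\<^sub>R (f i \<and>\<^sub>b f j))"
    by (rule arg_cong2[OF 1 2])
  also have "\<dots> = (\<Sum>i\<in>UNIV. \<Sum>j\<in>UNIV. (sig i * sig j * hat_metric b (u \<and>\<^sub>b v) (f i \<and>\<^sub>b f j)) *\<^sub>R (f i \<and>\<^sub>b f j))"
    unfolding sum.distrib[symmetric]
    by (intro sum.cong refl)
      (simp only: scaleR_left_distrib[symmetric] hat_metric_bivec[OF assms(1)], simp add: algebra_simps)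
  finally have "(1 / 2) *\<^sub>R 2 *\<^sub>R (u \<and>\<^sub>b v) = (1 / 2) *\<^sub>R (\<Sum>i\<in>UNIV. \<Sum>j\<in>UNIV.
      (sig i * sig j * hat_metric b (u \<and>\<^sub>b v) (f i \<and>\<^sub>b f j)) *\<^sub>R (f i \<and>\<^sub>b f j))"
    by (rule arg_cong)
  then show ?thesis
    by (simp only: scaleR_scaleR) simp
qed

text \<open>Shows that a value of the shape occurring in \<open>hat_D\<close> is determined by its
  pairings with the basis bivectors.\<close>

lemma bivec_sum_expansion:
  fixes s t :: "'k \<Rightarrow> real^4"
  assumes "bilinear b" "pseudo_orthonormal b f" "w = (\<Sum>k\<in>I. s k \<and>\<^sub>b t k + s' k \<and>\<^sub>b t' k)"
  shows "w = (1 / 2) *\<^sub>R (\<Sum>i\<in>UNIV. \<Sum>j\<in>UNIV.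
    (sig i * sig j * hat_metric b w (f i \<and>\<^sub>b f j)) *\<^sub>R (f i \<and>\<^sub>b f j))"
proof -
  \<comment> \<open>The right-hand side as an operator: it is additive and fixes every decomposable
    bivector, hence every sum of these.\<close>
  define E where "E \<theta> = (1 / 2) *\<^sub>R (\<Sum>i\<in>UNIV. \<Sum>j\<in>UNIV.
    (sig i * sig j * hat_metric b \<theta> (f i \<and>\<^sub>b f j)) *\<^sub>R (f i \<and>\<^sub>b f j))" for \<theta>
  have E0: "E 0 = 0"
    by (simp add: E_def)
  have E_add: "E (\<theta> + \<theta>') = E \<theta> + E \<theta>'" for \<theta> \<theta>'
    by (simp add: E_def hat_metric_add_left algebra_simps scaleR_left_distrib sum.distrib)
  have E_sum: "E (\<Sum>k\<in>I. \<theta> k) = (\<Sum>k\<in>I. E (\<theta> k))" for \<theta>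
    by (induction I rule: infinite_finite_induct) (simp_all add: E0 E_add)
  have "E (u \<and>\<^sub>b v) = u \<and>\<^sub>b v" for u v
    unfolding E_def by (rule bivec_expansion[OF assms(1,2), symmetric])
  then have "E w = w"
    unfolding assms(3) by (simp add: E_sum E_add)
  then show ?thesis
    by (simp add: E_def)
qed

section \<open>Smooth sections and representations of bivector fields by them\<close>

lemma oriented_bundle_open:
  assumes "oriented_bundle A" "(U, F) \<in> A"
  shows "open U"
proof -
  have "\<forall>(U, F)\<in>A. open U \<and> (\<forall>x\<in>U. invertible (F x))"
    using assms(1) unfolding oriented_bundle_def by (elim conjE)
  from bspec[OF this assms(2)] show ?thesis
    by simp
qed

lemma smooth_sectionD:
  "smooth_section A s \<Longrightarrow> (U, F) \<in> A \<Longrightarrow> smooth_on U (\<lambda>x. F x *v s x)"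
  using bspec[of A "\<lambda>(U, F). smooth_on U (\<lambda>x. F x *v s x)" "(U, F)"] by (simp add: smooth_section_def)

lemma smooth_section_add:
  assumes "oriented_bundle A" "smooth_section A s" "smooth_section A t"
  shows "smooth_section A (\<lambda>x. s x + t x)"
  unfolding smooth_section_def
proof (safe)
  fix U F
  assume UF: "(U, F) \<in> A"
  show "smooth_on U (\<lambda>x. F x *v (s x + t x))"
    unfolding matrix_vector_right_distrib
    by (intro smooth_on_add oriented_bundle_open[OF assms(1) UF] smooth_sectionD[OF _ UF] assms(2,3))
qed

lemma smooth_section_scaleR:
  assumes "oriented_bundle A" "smooth_on UNIV \<phi>" "smooth_section A s"
  shows "smooth_section A (\<lambda>x. \<phi> x *\<^sub>R s x)"
  unfolding smooth_section_def
proof (safe)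
  fix U F
  assume UF: "(U, F) \<in> A"
  have "smooth_on U (\<lambda>x. \<phi> x *\<^sub>R (F x *v s x))"
    by (intro smooth_on_scaleR oriented_bundle_open[OF assms(1) UF] smooth_sectionD[OF _ UF]
        smooth_on_subset[OF assms(2)] assms(3) subset_UNIV)
  then show "smooth_on U (\<lambda>x. F x *v (\<phi> x *\<^sub>R s x))"
    by (simp add: matrix_vector_mult_scaleR)
qed

text \<open>The property under the definite description of \<open>hat_D\<close>, kept as a relation
  so that sum and product rules can be proved before uniqueness.\<close>

definition has_hat_D ::
  "('m::finite, 'n::finite) atlas \<Rightarrow> ('m, 'n) cov_deriv \<Rightarrow> (real^'m \<Rightarrow> real^'n^'n) \<Rightarrow>
   real^'m \<Rightarrow> real^'m \<Rightarrow> real^'n^'n \<Rightarrow> bool" where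
  "has_hat_D A D \<Theta> x v w \<longleftrightarrow> (\<exists>N::nat. \<exists>s t U.
     open U \<and> x \<in> U \<and>
     (\<forall>k<N. smooth_section A (s k) \<and> smooth_section A (t k)) \<and>
     (\<forall>y\<in>U. \<Theta> y = (\<Sum>k<N. s k y \<and>\<^sub>b t k y)) \<and>
     w = (\<Sum>k<N. D (s k) x v \<and>\<^sub>b t k x + s k x \<and>\<^sub>b D (t k) x v))"

lemma has_hat_D_cases:
  assumes "has_hat_D A D \<Theta> x v w"
  obtains N :: nat and s t U where "open U" "x \<in> U"
    "\<And>k. k < N \<Longrightarrow> smooth_section A (s k)" "\<And>k. k < N \<Longrightarrow> smooth_section A (t k)"
    "\<And>y. y \<in> U \<Longrightarrow> \<Theta> y = (\<Sum>k<N. s k y \<and>\<^sub>b t k y)"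
    "w = (\<Sum>k<N. D (s k) x v \<and>\<^sub>b t k x + s k x \<and>\<^sub>b D (t k) x v)"
proof -
  from assms obtain N :: nat and s t U where *: "open U \<and> x \<in> U \<and>
     (\<forall>k<N. smooth_section A (s k) \<and> smooth_section A (t k)) \<and>
     (\<forall>y\<in>U. \<Theta> y = (\<Sum>k<N. s k y \<and>\<^sub>b t k y)) \<and>
     w = (\<Sum>k<N. D (s k) x v \<and>\<^sub>b t k x + s k x \<and>\<^sub>b D (t k) x v)"
    unfolding has_hat_D_def by (elim exE) (rule that)
  show ?thesis
    by (rule that[of U N s t]) (use * in simp_all)
qed

lemma has_hat_D_bivec:
  assumes "smooth_section A s" "smooth_section A t"
  shows "has_hat_D A D (\<lambda>y. s y \<and>\<^sub>b t y) x v (D s x v \<and>\<^sub>b t x + s x \<and>\<^sub>b D t x v)"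
  unfolding has_hat_D_def
  by (rule exI[of _ 1], rule exI[of _ "\<lambda>_. s"], rule exI[of _ "\<lambda>_. t"], rule exI[of _ UNIV])
    (simp add: assms)

lemma sum_lessThan_add:
  fixes f :: "nat \<Rightarrow> 'a::comm_monoid_add"
  shows "(\<Sum>k<M + N. f k) = (\<Sum>k<M. f k) + (\<Sum>k<N. f (M + k))"
  by (induction N) (simp_all add: add.assoc)

text \<open>The two representations are concatenated over the intersection of their neighbourhoods;
  the index of the second one is shifted by N.\<close>

lemma has_hat_D_add:
  assumes "has_hat_D A D \<Theta> x v w" "has_hat_D A D \<Theta>' x v w'"
  shows "has_hat_D A D (\<lambda>y. \<Theta> y + \<Theta>' y) x v (w + w')"
proof -
  obtain N :: nat and s t U where 1: "open U" "x \<in> U"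
    "\<And>k. k < N \<Longrightarrow> smooth_section A (s k)" "\<And>k. k < N \<Longrightarrow> smooth_section A (t k)"
    "\<And>y. y \<in> U \<Longrightarrow> \<Theta> y = (\<Sum>k<N. s k y \<and>\<^sub>b t k y)"
    "w = (\<Sum>k<N. D (s k) x v \<and>\<^sub>b t k x + s k x \<and>\<^sub>b D (t k) x v)"
    using assms(1) by (rule has_hat_D_cases) (rule that)
  obtain N' :: nat and s' t' U' where 2: "open U'" "x \<in> U'"
    "\<And>k. k < N' \<Longrightarrow> smooth_section A (s' k)" "\<And>k. k < N' \<Longrightarrow> smooth_section A (t' k)"
    "\<And>y. y \<in> U' \<Longrightarrow> \<Theta>' y = (\<Sum>k<N'. s' k y \<and>\<^sub>b t' k y)"
    "w' = (\<Sum>k<N'. D (s' k) x v \<and>\<^sub>b t' k x + s' k x \<and>\<^sub>b D (t' k) x v)"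
    using assms(2) by (rule has_hat_D_cases) (rule that)
  show ?thesis
    unfolding has_hat_D_def
  proof (intro exI conjI)
    show "open (U \<inter> U')" "x \<in> U \<inter> U'"
      using 1 2 by auto
    show "\<forall>k<N + N'. smooth_section A (if k < N then s k else s' (k - N)) \<and>
        smooth_section A (if k < N then t k else t' (k - N))"
      using 1(3,4) 2(3,4) by auto
    show "\<forall>y\<in>U \<inter> U'. \<Theta> y + \<Theta>' y =
        (\<Sum>k<N + N'. (if k < N then s k else s' (k - N)) y \<and>\<^sub>b (if k < N then t k else t' (k - N)) y)"
      by (simp add: sum_lessThan_add 1(5) 2(5))
    show "w + w' = (\<Sum>k<N + N'. D (if k < N then s k else s' (k - N)) x v \<and>\<^sub>b (if k < N then t k else t' (k - N)) x +
        (if k < N then s k else s' (k - N)) x \<and>\<^sub>b D (if k < N then t k else t' (k - N)) x v)"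
      by (simp add: sum_lessThan_add 1(6) 2(6))
  qed
qed

text \<open>The function is absorbed into the first factor of each product, where the Leibniz rule
  of \<open>D\<close> applies.\<close>

lemma has_hat_D_scaleR:
  assumes "oriented_bundle A" "connection A D" "smooth_on UNIV \<phi>" "has_hat_D A D \<Theta> x v w"
  shows "has_hat_D A D (\<lambda>y. \<phi> y *\<^sub>R \<Theta> y) x v (diff_form \<phi> x v *\<^sub>R \<Theta> x + \<phi> x *\<^sub>R w)"
proof -
  obtain N :: nat and s t U where 1: "open U" "x \<in> U"
    "\<And>k. k < N \<Longrightarrow> smooth_section A (s k)" "\<And>k. k < N \<Longrightarrow> smooth_section A (t k)"
    "\<And>y. y \<in> U \<Longrightarrow> \<Theta> y = (\<Sum>k<N. s k y \<and>\<^sub>b t k y)"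
    "w = (\<Sum>k<N. D (s k) x v \<and>\<^sub>b t k x + s k x \<and>\<^sub>b D (t k) x v)"
    using assms(4) by (rule has_hat_D_cases) (rule that)
  have D: "D (\<lambda>y. \<phi> y *\<^sub>R s k y) x v = diff_form \<phi> x v *\<^sub>R s k x + \<phi> x *\<^sub>R D (s k) x v" if "k < N" for k
    using assms(2,3) 1(3)[OF that] unfolding connection_def by simp
  show ?thesis
    unfolding has_hat_D_def
  proof (intro exI conjI)
    show "\<forall>k<N. smooth_section A (\<lambda>y. \<phi> y *\<^sub>R s k y) \<and> smooth_section A (t k)"
      using 1(3,4) smooth_section_scaleR[OF assms(1,3)] by simp
    show "\<forall>y\<in>U. \<phi> y *\<^sub>R \<Theta> y = (\<Sum>k<N. (\<phi> y *\<^sub>R s k y) \<and>\<^sub>b t k y)"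
      by (simp add: 1(5) bivec_scaleR_left scaleR_sum_right)
    show "diff_form \<phi> x v *\<^sub>R \<Theta> x + \<phi> x *\<^sub>R w =
      (\<Sum>k<N. D (\<lambda>y. \<phi> y *\<^sub>R s k y) x v \<and>\<^sub>b t k x + (\<phi> x *\<^sub>R s k x) \<and>\<^sub>b D (t k) x v)"
      by (simp add: D 1(2,5,6) bivec_scaleR_left bivec_add_left scaleR_sum_right scaleR_right_distrib
          sum.distrib add.assoc)
  qed (use 1 in auto)
qed

section \<open>Pseudo-orthonormal frames\<close>

locale neutral_bundle =
  fixes A :: "('m::finite, 4) atlas"
    and h :: "real^'m \<Rightarrow> real^4 \<Rightarrow> real^4 \<Rightarrow> real"
    and D :: "('m, 4) cov_deriv"
    and e :: "4 \<Rightarrow> real^'m \<Rightarrow> real^4"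
  assumes oriented: "oriented_bundle A"
    and neutral: "neutral_metric A h"
    and metric: "metric_connection A h D"
    and frame: "pseudo_orthonormal_frame A h e"
begin

lemma connection: "connection A D"
  using metric by (simp add: metric_connection_def)

lemma bilinear_h: "bilinear (h x)"
  and h_sym: "h x u v = h x v u"
  using neutral by (simp_all add: neutral_metric_def)

lemma smooth_inner:
  "smooth_section A s \<Longrightarrow> smooth_section A t \<Longrightarrow> smooth_on UNIV (\<lambda>x. h x (s x) (t x))"
  using neutral by (simp add: neutral_metric_def)

lemma smooth_e: "smooth_section A (e i)"
  and orthonormal: "pseudo_orthonormal (h x) (\<lambda>i. e i x)"
  using frame by (simp_all add: pseudo_orthonormal_frame_def)

lemmas inner_e = pseudo_orthonormal_inner[OF orthonormal]
lemmas h_coefficient = pseudo_orthonormal_coefficient[OF bilinear_h orthonormal]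
lemmas hat_metric_h = hat_metric_bivec[OF bilinear_h]

text \<open>Metric compatibility fixes the value of \<open>diff_form\<close>; smoothness of the
  metric on sections adds that the derivative exists.\<close>

lemma inner_has_derivative:
  assumes "smooth_section A s" "smooth_section A t"
  shows "((\<lambda>y. h y (s y) (t y)) has_derivative
    (\<lambda>v. h x (D s x v) (t x) + h x (s x) (D t x v))) (at x)"
proof -
  have "diff_form (\<lambda>y. h y (s y) (t y)) x = (\<lambda>v. h x (D s x v) (t x) + h x (s x) (D t x v))"
    using metric assms by (simp add: metric_connection_def fun_eq_iff)
  then show ?thesis
    using smooth_on_has_derivative[OF smooth_inner[OF assms], of x] by simp
qed

text \<open>Compatibility of the induced metric with the induced derivative: the product rule
  applied to the 2 by 2 determinant of \<open>hat_metric_bivec\<close>.\<close>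

lemma hat_metric_has_derivative:
  assumes "smooth_section A s" "smooth_section A t" "smooth_section A p" "smooth_section A q"
  shows "((\<lambda>y. hat_metric (h y) (s y \<and>\<^sub>b t y) (p y \<and>\<^sub>b q y)) has_derivative
    (\<lambda>v. hat_metric (h x) (D s x v \<and>\<^sub>b t x + s x \<and>\<^sub>b D t x v) (p x \<and>\<^sub>b q x) +
      hat_metric (h x) (s x \<and>\<^sub>b t x) (D p x v \<and>\<^sub>b q x + p x \<and>\<^sub>b D q x v))) (at x)"
  unfolding hat_metric_add_left hat_metric_add_right hat_metric_h
  by (rule has_derivative_eq_rhs[OF has_derivative_diff
        [OF has_derivative_mult[OF inner_has_derivative[OF assms(1,3)] inner_has_derivative[OF assms(2,4)]]
          has_derivative_mult[OF inner_has_derivative[OF assms(1,4)] inner_has_derivative[OF assms(2,3)]]]])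
    (simp add: fun_eq_iff algebra_simps)

text \<open>Since the connection is metric, the right-hand side depends on the bivector field only and not
  on its representation by products of sections; this makes the description in \<^const>\<open>hat_D\<close> unique.\<close>

lemma has_hat_D_value:
  assumes "has_hat_D A D \<Theta> x v w"
  shows "w = (1 / 2) *\<^sub>R (\<Sum>i\<in>UNIV. \<Sum>j\<in>UNIV. (sig i * sig j *
    (diff_form (\<lambda>y. hat_metric (h y) (\<Theta> y) (e i y \<and>\<^sub>b e j y)) x v -
      hat_metric (h x) (\<Theta> x) (D (e i) x v \<and>\<^sub>b e j x + e i x \<and>\<^sub>b D (e j) x v))) *\<^sub>R (e i x \<and>\<^sub>b e j x))"
proof -
  obtain N :: nat and s t U where U: "open U" "x \<in> U"
    and s: "\<And>k. k < N \<Longrightarrow> smooth_section A (s k)" and t: "\<And>k. k < N \<Longrightarrow> smooth_section A (t k)"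
    and \<Theta>: "\<And>y. y \<in> U \<Longrightarrow> \<Theta> y = (\<Sum>k<N. s k y \<and>\<^sub>b t k y)"
    and w: "w = (\<Sum>k<N. D (s k) x v \<and>\<^sub>b t k x + s k x \<and>\<^sub>b D (t k) x v)"
    using assms by (rule has_hat_D_cases) (rule that)
  have coeff: "hat_metric (h x) w (e i x \<and>\<^sub>b e j x) =
      diff_form (\<lambda>y. hat_metric (h y) (\<Theta> y) (e i y \<and>\<^sub>b e j y)) x v -
      hat_metric (h x) (\<Theta> x) (D (e i) x v \<and>\<^sub>b e j x + e i x \<and>\<^sub>b D (e j) x v)" for i j
  proof -
    have "((\<lambda>y. \<Sum>k<N. hat_metric (h y) (s k y \<and>\<^sub>b t k y) (e i y \<and>\<^sub>b e j y)) has_derivative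
      (\<lambda>v. \<Sum>k<N. hat_metric (h x) (D (s k) x v \<and>\<^sub>b t k x + s k x \<and>\<^sub>b D (t k) x v) (e i x \<and>\<^sub>b e j x) +
        hat_metric (h x) (s k x \<and>\<^sub>b t k x) (D (e i) x v \<and>\<^sub>b e j x + e i x \<and>\<^sub>b D (e j) x v))) (at x)"
      by (rule has_derivative_sum) (simp add: hat_metric_has_derivative s t smooth_e)
    \<comment> \<open>The representation of \<Theta> holds only on U, which is enough for a
      derivative at x.\<close>
    then have "((\<lambda>y. hat_metric (h y) (\<Theta> y) (e i y \<and>\<^sub>b e j y)) has_derivative
      (\<lambda>v. \<Sum>k<N. hat_metric (h x) (D (s k) x v \<and>\<^sub>b t k x + s k x \<and>\<^sub>b D (t k) x v) (e i x \<and>\<^sub>b e j x) +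
        hat_metric (h x) (s k x \<and>\<^sub>b t k x) (D (e i) x v \<and>\<^sub>b e j x + e i x \<and>\<^sub>b D (e j) x v))) (at x)"
      by (rule has_derivative_transform_within_open[OF _ U]) (simp add: \<Theta> hat_metric_sum_left)
    from diff_form_eqI[OF this] show ?thesis
      unfolding w \<Theta>[OF U(2)] hat_metric_sum_left by (simp add: sum.distrib)
  qed
  show ?thesis
    unfolding coeff[symmetric] by (rule bivec_sum_expansion[OF bilinear_h orthonormal w])
qed

lemma hat_D_eqI:
  assumes "has_hat_D A D \<Theta> x v w"
  shows "hat_D A D \<Theta> x v = w"
proof -
  have "w' = w" if "has_hat_D A D \<Theta> x v w'" for w'
    using has_hat_D_value[OF that] has_hat_D_value[OF assms] by simp
  then show ?thesis
    using assms unfolding hat_D_def has_hat_D_def[symmetric] by (intro the_equality)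
qed

lemma has_hat_D_e:
  "has_hat_D A D (\<lambda>y. c *\<^sub>R (e i y \<and>\<^sub>b e j y)) x v
    (c *\<^sub>R (D (e i) x v \<and>\<^sub>b e j x + e i x \<and>\<^sub>b D (e j) x v))"
  using has_hat_D_scaleR[OF oriented connection smooth_on_const[of UNIV c]
      has_hat_D_bivec[OF smooth_e smooth_e]]
  by simp

lemma D_frame_combination:
  assumes "\<And>i. smooth_on UNIV (\<phi> i)"
  shows "D (\<lambda>y. \<Sum>i\<in>UNIV. \<phi> i y *\<^sub>R e i y) x v =
    (\<Sum>i\<in>UNIV. diff_form (\<phi> i) x v *\<^sub>R e i x + \<phi> i x *\<^sub>R D (e i) x v)"
proof -
  note sm = smooth_section_scaleR[OF oriented assms smooth_e]
  have add: "D (\<lambda>y. s y + t y) x v = D s x v + D t x v"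
    if "smooth_section A s" "smooth_section A t" for s t
    using connection that by (simp add: connection_def)
  have scale: "D (\<lambda>y. \<phi> i y *\<^sub>R e i y) x v = diff_form (\<phi> i) x v *\<^sub>R e i x + \<phi> i x *\<^sub>R D (e i) x v" for i
    using connection assms smooth_e by (simp add: connection_def)
  show ?thesis
    by (simp add: sum_4 add scale sm smooth_section_add[OF oriented])
qed

end

section \<open>The connection form and its structure equation\<close>

locale flat_neutral_bundle = neutral_bundle A h D e
  for A :: "('m::finite, 4) atlas" and h D e +
  fixes \<omega> :: "4 \<Rightarrow> 4 \<Rightarrow> real^'m \<Rightarrow> real^'m \<Rightarrow> real"
  assumes flat: "flat A D"
    and form: "connection_form D e \<omega>"
begin

lemma D_e: "D (e j) x v = (\<Sum>i\<in>UNIV. \<omega> i j x v *\<^sub>R e i x)"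
  using form by (simp add: connection_form_def)

text \<open>Linearity and smoothness of the connection form are read off from this formula.\<close>

lemma \<omega>_eq: "\<omega> i j x v = sig i * h x (D (e j) x v) (e i x)"
  unfolding D_e h_coefficient by (simp add: mult.assoc[symmetric])

lemma linear_\<omega>: "linear (\<omega> i j x)"
proof -
  have "linear (D (e j) x)"
    using connection smooth_e by (simp add: connection_def)
  moreover have "linear (\<lambda>u. h x u (e i x))"
    using bilinear_h by (simp add: bilinear_def)
  ultimately have L: "linear (\<lambda>v. h x (D (e j) x v) (e i x))"
    using linear_compose by (force simp: o_def)
  show ?thesis
    unfolding \<omega>_eq[abs_def]
    by (rule linearI) (simp_all add: linear_add[OF L] linear_cmul[OF L] algebra_simps)
qed

lemma smooth_D_e: "smooth_section A (\<lambda>y. D (e j) y v)"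
proof -
  have *: "\<And>s X. smooth_section A s \<Longrightarrow> smooth_on UNIV X \<Longrightarrow> smooth_section A (\<lambda>x. D s x (X x))"
    using connection by (simp add: connection_def)
  show ?thesis
    by (rule *[OF smooth_e smooth_on_const])
qed

lemma smooth_\<omega>: "smooth_on UNIV (\<lambda>x. \<omega> i j x v)"
  unfolding \<omega>_eq
  by (intro smooth_on_mult smooth_on_const smooth_inner smooth_D_e smooth_e open_UNIV)

text \<open>Differentiating the constant functions h(e_i, e_j) shows that the connection form takes
  values in so(2,2).\<close>

lemma \<omega>_skew: "sig i * \<omega> i j x v + sig j * \<omega> j i x v = 0"
proof -
  have "diff_form (\<lambda>y. h y (e i y) (e j y)) x v = 0"
    by (simp add: inner_e)
  then have "h x (D (e i) x v) (e j x) + h x (e i x) (D (e j) x v) = 0"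
    by (simp add: diff_form_eqI[OF inner_has_derivative[OF smooth_e smooth_e]])
  then show ?thesis
    by (simp add: \<omega>_eq h_sym[of x "e i x"] mult.assoc[symmetric])
qed

text \<open>Normal form: everything is expressed by the six entries below the diagonal.\<close>

lemma \<omega>_simps:
  "\<omega> 1 1 x v = 0" "\<omega> 2 2 x v = 0" "\<omega> 3 3 x v = 0" "\<omega> 4 4 x v = 0"
  "\<omega> 1 2 x v = - \<omega> 2 1 x v" "\<omega> 1 3 x v = \<omega> 3 1 x v" "\<omega> 1 4 x v = \<omega> 4 1 x v"
  "\<omega> 2 3 x v = \<omega> 3 2 x v" "\<omega> 2 4 x v = \<omega> 4 2 x v" "\<omega> 3 4 x v = - \<omega> 4 3 x v"
  using \<omega>_skew[of 1 1] \<omega>_skew[of 2 2] \<omega>_skew[of 3 3] \<omega>_skew[of 4 4] \<omega>_skew[of 1 2 x v]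
    \<omega>_skew[of 1 3 x v] \<omega>_skew[of 1 4 x v] \<omega>_skew[of 2 3 x v] \<omega>_skew[of 2 4 x v] \<omega>_skew[of 3 4 x v]
  by simp_all

text \<open>Cartan's equation for zero curvature, obtained by testing the curvature on constant
  vector fields.\<close>

lemma structure_equation:
  "ext_d (\<omega> i j) x u v = - (\<Sum>k\<in>UNIV. (\<omega> i k \<and>\<^sub>f \<omega> k j) x u v)"
proof -
  \<comment> \<open>The i-th frame coefficient of the second covariant derivative of e_j along
    constant fields u and v.\<close>
  have coeff: "sig i * h x (D (\<lambda>y. D (e j) y v) x u) (e i x) =
      diff_form (\<lambda>y. \<omega> i j y v) x u + (\<Sum>k\<in>UNIV. \<omega> i k x u * \<omega> k j x v)" for u v
  proof -
    have "D (\<lambda>y. D (e j) y v) x u = D (\<lambda>y. \<Sum>k\<in>UNIV. \<omega> k j y v *\<^sub>R e k y) x u"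
      by (simp only: D_e)
    also have "\<dots> = (\<Sum>k\<in>UNIV. diff_form (\<lambda>y. \<omega> k j y v) x u *\<^sub>R e k x + \<omega> k j x v *\<^sub>R D (e k) x u)"
      by (rule D_frame_combination[OF smooth_\<omega>])
    also have "\<dots> = (\<Sum>l\<in>UNIV. (diff_form (\<lambda>y. \<omega> l j y v) x u + (\<Sum>k\<in>UNIV. \<omega> l k x u * \<omega> k j x v)) *\<^sub>R e l x)"
      unfolding D_e sum_4 by (simp add: algebra_simps)
    finally show ?thesis
      by (simp add: h_coefficient mult.assoc[symmetric])
  qed
  \<comment> \<open>Constant fields have zero bracket, so the last term of the curvature is
    \<open>D (e j) x 0\<close>.\<close>
  have D0: "D (e j) x 0 = 0"
    using connection smooth_e linear_0 by (force simp: connection_def)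
  have "curvature D (\<lambda>_. u) (\<lambda>_. v) (e j) x = 0"
    using flat smooth_e smooth_on_const by (force simp: flat_def)
  then have "D (\<lambda>y. D (e j) y v) x u = D (\<lambda>y. D (e j) y u) x v"
    by (simp add: curvature_def lie_bracket_def D0)
  then show ?thesis
    using coeff[of u v] coeff[of v u]
    by (simp add: ext_d_def form_wedge_def sum_subtractf algebra_simps)
qed

end

section \<open>The flat connection in the frame\<close>

lemma ext_d_combination:
  assumes "\<And>w. (\<lambda>y. a y w) differentiable (at x)" "\<And>w. (\<lambda>y. b y w) differentiable (at x)"
  shows "ext_d (\<lambda>y w. a y w + c * b y w) x u v = ext_d a x u v + c * ext_d b x u v"
proof -
  have "diff_form (\<lambda>y. a y w + c * b y w) x = (\<lambda>v. diff_form (\<lambda>y. a y w) x v + c * diff_form (\<lambda>y. b y w) x v)" for w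
    using assms
    by (intro diff_form_eqI has_derivative_add has_derivative_mult_right has_derivative_diff_form)
  then show ?thesis
    by (simp add: ext_d_def algebra_simps)
qed

lemma ext_d_function_mult:
  fixes \<phi> :: "'a::real_normed_vector \<Rightarrow> real"
  assumes "(\<phi> has_derivative \<phi>') (at x)" "\<And>w. (\<lambda>y. a y w) differentiable (at x)"
  shows "ext_d (\<lambda>y w. \<phi> y * a y w) x u v = \<phi>' u * a x v - \<phi>' v * a x u + \<phi> x * ext_d a x u v"
proof -
  have "diff_form (\<lambda>y. \<phi> y * a y w) x = (\<lambda>v. \<phi> x * diff_form (\<lambda>y. a y w) x v + \<phi>' v * a x w)" for w
    by (intro diff_form_eqI has_derivative_mult has_derivative_diff_form assms)
  then show ?thesis
    by (simp add: ext_d_def algebra_simps)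
qed

text \<open>A vector space is not the union of two proper subspaces, here those given by q = p and q
  = - p.\<close>

lemma linear_forms_equal_squares:
  fixes p q :: "'a::real_vector \<Rightarrow> real"
  assumes "linear p" "linear q" "\<And>v. (p v)\<^sup>2 = (q v)\<^sup>2"
  shows "(\<forall>v. q v = p v) \<or> (\<forall>v. q v = - p v)"
proof (rule ccontr)
  assume "\<not> ?thesis"
  then obtain u w where u: "q u \<noteq> p u" and w: "q w \<noteq> - p w"
    by blast
  have "q u = - p u" "q w = p w"
    using assms(3)[of u] assms(3)[of w] u w by (auto simp: power2_eq_iff)
  \<comment> \<open>The sum u + w would lie in neither subspace; comparing the squares there
    isolates the mixed term.\<close>
  moreover have "(p u + p w)\<^sup>2 = (q u + q w)\<^sup>2"
    using assms(3)[of "u + w"] by (simp add: linear_add[OF assms(1)] linear_add[OF assms(2)])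
  ultimately have "p u * p w = 0"
    by (simp add: power2_eq_square algebra_simps)
  then show False
    using u w \<open>q u = - p u\<close> \<open>q w = p w\<close> by auto
qed

text \<open>Pointwise the sign exists by linear algebra. The sets where it is 1 or - 1 are closed
  and cover the space, and they are disjoint as \<alpha> vanishes nowhere, so connectedness leaves
  one of them.\<close>

lemma one_forms_equal_squares:
  fixes \<alpha> \<beta> :: "'a::real_normed_vector \<Rightarrow> 'a \<Rightarrow> real"
  assumes lin: "\<And>x. linear (\<alpha> x)" "\<And>x. linear (\<beta> x)"
    and cont: "\<And>v. continuous_on UNIV (\<lambda>x. \<alpha> x v)" "\<And>v. continuous_on UNIV (\<lambda>x. \<beta> x v)"
    and sq: "\<And>x v. (\<alpha> x v)\<^sup>2 = (\<beta> x v)\<^sup>2" and nz: "\<And>x. \<exists>v. \<alpha> x v \<noteq> 0"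
  obtains \<mu> where "\<mu> \<in> {1, - 1}" "\<And>x v. \<beta> x v = \<mu> * \<alpha> x v"
proof -
  define P where "P \<mu> = (\<Inter>v. {x. \<beta> x v = \<mu> * \<alpha> x v})" for \<mu> :: real
  have closed: "closed (P \<mu>)" for \<mu>
    unfolding P_def
    by (intro closed_INT ballI closed_Collect_eq continuous_on_mult continuous_on_const cont)
  have cover: "x \<in> P 1 \<or> x \<in> P (- 1)" for x
    using linear_forms_equal_squares[OF lin sq, of x] by (simp add: P_def)
  have "x \<notin> P 1 \<inter> P (- 1)" for x
  proof -
    obtain v where v: "\<alpha> x v \<noteq> 0"
      using nz by blast
    show ?thesis
    proof
      assume "x \<in> P 1 \<inter> P (- 1)"
      then have "\<beta> x v = 1 * \<alpha> x v" "\<beta> x v = - 1 * \<alpha> x v"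
        unfolding P_def by blast+
      with v show False by simp
    qed
  qed
  then have disj: "P 1 \<inter> P (- 1) \<inter> UNIV = {}" by blast
  have "UNIV \<subseteq> P 1 \<union> P (- 1)"
    using cover by blast
  from connected_closedD[OF connected_UNIV disj this closed closed]
  have "P 1 = {} \<or> P (- 1) = {}" by simp
  then have "P 1 = UNIV \<or> P (- 1) = UNIV"
    using cover by blast
  then obtain \<mu> where "\<mu> \<in> {1, - 1}" "P \<mu> = UNIV" by blast
  then show ?thesis
    using that[of \<mu>] by (auto simp: P_def)
qed

section \<open>The induced connection on the rank 3 bundle\<close>

context flat_neutral_bundle
begin

text \<open>These are the coefficients appearing in \<open>has_hat_D_Omega1\<close>,
  \<open>has_hat_D_Omega2\<close> and \<open>has_hat_D_Omega3\<close>. All three have the shape a +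
  c * b of \<open>ext_d_combination\<close>, which explains the spelling
  \<open>+ - \<epsilon> *\<close> in \<open>gamma\<close>.\<close>

definition alpha where "alpha \<epsilon> x v = \<omega> 3 2 x v + \<epsilon> * \<omega> 4 1 x v"
definition beta where "beta \<epsilon> x v = \<omega> 4 3 x v + \<epsilon> * \<omega> 2 1 x v"
definition gamma where "gamma \<epsilon> x v = \<omega> 4 2 x v + - \<epsilon> * \<omega> 3 1 x v"

lemma linear_alpha: "linear (alpha \<epsilon> x)" and linear_beta: "linear (beta \<epsilon> x)"
  and linear_gamma: "linear (gamma \<epsilon> x)"
  by (rule linearI; simp add: alpha_def beta_def gamma_def linear_add[OF linear_\<omega>]
      linear_cmul[OF linear_\<omega>] algebra_simps)+

lemma smooth_alpha: "smooth_on UNIV (\<lambda>x. alpha \<epsilon> x v)"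
  and smooth_beta: "smooth_on UNIV (\<lambda>x. beta \<epsilon> x v)"
  and smooth_gamma: "smooth_on UNIV (\<lambda>x. gamma \<epsilon> x v)"
  unfolding alpha_def beta_def gamma_def
  by (intro smooth_on_add smooth_on_mult smooth_on_const smooth_\<omega> open_UNIV)+

lemma differentiable_\<omega>: "(\<lambda>y. \<omega> i j y w) differentiable (at x)"
  using smooth_on_has_derivative[OF smooth_\<omega>] by (blast intro: differentiableI)

lemmas ext_d_\<omega>_combination = ext_d_combination[OF differentiable_\<omega> differentiable_\<omega>]

text \<open>Reflects the splitting of so(2,2) into two copies of so(1,2), one for each sign: terms
  belonging to the opposite sign cancel.\<close>

lemma ext_d_alpha:
  assumes "\<epsilon> \<in> {1, - 1}"
  shows "ext_d (alpha \<epsilon>) x u v = (beta \<epsilon> \<and>\<^sub>f gamma \<epsilon>) x u v"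
proof -
  have "ext_d (alpha \<epsilon>) x u v = ext_d (\<omega> 3 2) x u v + \<epsilon> * ext_d (\<omega> 4 1) x u v"
    unfolding alpha_def[abs_def] by (rule ext_d_\<omega>_combination)
  then show ?thesis
    using assms
    by (auto simp: structure_equation sum_4 \<omega>_simps form_wedge_def beta_def gamma_def algebra_simps)
qed

lemma ext_d_gamma:
  assumes "\<epsilon> \<in> {1, - 1}"
  shows "ext_d (gamma \<epsilon>) x u v = (alpha \<epsilon> \<and>\<^sub>f beta \<epsilon>) x u v"
proof -
  have "ext_d (gamma \<epsilon>) x u v = ext_d (\<omega> 4 2) x u v + - \<epsilon> * ext_d (\<omega> 3 1) x u v"
    unfolding gamma_def[abs_def] by (rule ext_d_\<omega>_combination)
  then show ?thesis
    using assms
    by (auto simp: structure_equation sum_4 \<omega>_simps form_wedge_def alpha_def beta_def algebra_simps)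
qed

text \<open>Common pattern of the three fields \<open>Omega1\<close>, \<open>Omega2\<close> and
  \<open>Omega3\<close>.\<close>

lemma has_hat_D_e_pair:
  "has_hat_D A D (\<lambda>y. r *\<^sub>R (e i y \<and>\<^sub>b e j y + c *\<^sub>R (e k y \<and>\<^sub>b e l y))) x v
    (r *\<^sub>R ((D (e i) x v \<and>\<^sub>b e j x + e i x \<and>\<^sub>b D (e j) x v) +
      c *\<^sub>R (D (e k) x v \<and>\<^sub>b e l x + e k x \<and>\<^sub>b D (e l) x v)))"
  using has_hat_D_add[OF has_hat_D_e[of r i j x v] has_hat_D_e[of "r * c" k l x v]]
  by (simp only: scaleR_add_right scaleR_scaleR)

lemma has_hat_D_Omega1:
  assumes "\<epsilon> \<in> {1, - 1}"
  shows "has_hat_D A D (Omega1 (- \<epsilon>) e) x v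
    (alpha \<epsilon> x v *\<^sub>R Omega2 \<epsilon> e x + gamma \<epsilon> x v *\<^sub>R Omega3 \<epsilon> e x)"
proof -
  \<comment> \<open>Naming the factor keeps the square root out of the componentwise
    comparison.\<close>
  define r where "r = 1 / sqrt 2"
  have "r *\<^sub>R ((D (e 1) x v \<and>\<^sub>b e 2 x + e 1 x \<and>\<^sub>b D (e 2) x v) +
      (- \<epsilon>) *\<^sub>R (D (e 3) x v \<and>\<^sub>b e 4 x + e 3 x \<and>\<^sub>b D (e 4) x v)) =
    alpha \<epsilon> x v *\<^sub>R Omega2 \<epsilon> e x + gamma \<epsilon> x v *\<^sub>R Omega3 \<epsilon> e x"
    using assms unfolding Omega2_def Omega3_def r_def[symmetric]
    by (auto simp: D_e sum_4 \<omega>_simps alpha_def gamma_def vec_eq_iff bivec_def algebra_simps)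
  then show ?thesis
    using has_hat_D_e_pair[of r 1 2 "- \<epsilon>" 3 4 x v] unfolding Omega1_def[abs_def] r_def by simp
qed

lemma has_hat_D_Omega2:
  assumes "\<epsilon> \<in> {1, - 1}"
  shows "has_hat_D A D (Omega2 \<epsilon> e) x v
    (alpha \<epsilon> x v *\<^sub>R Omega1 (- \<epsilon>) e x + beta \<epsilon> x v *\<^sub>R Omega3 \<epsilon> e x)"
proof -
  define r where "r = 1 / sqrt 2"
  have "r *\<^sub>R ((D (e 1) x v \<and>\<^sub>b e 3 x + e 1 x \<and>\<^sub>b D (e 3) x v) +
      \<epsilon> *\<^sub>R (D (e 4) x v \<and>\<^sub>b e 2 x + e 4 x \<and>\<^sub>b D (e 2) x v)) =
    alpha \<epsilon> x v *\<^sub>R Omega1 (- \<epsilon>) e x + beta \<epsilon> x v *\<^sub>R Omega3 \<epsilon> e x"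
    using assms unfolding Omega1_def Omega3_def r_def[symmetric]
    by (auto simp: D_e sum_4 \<omega>_simps alpha_def beta_def vec_eq_iff bivec_def algebra_simps)
  then show ?thesis
    using has_hat_D_e_pair[of r 1 3 \<epsilon> 4 2 x v] unfolding Omega2_def[abs_def] r_def by simp
qed

lemma has_hat_D_Omega3:
  assumes "\<epsilon> \<in> {1, - 1}"
  shows "has_hat_D A D (Omega3 \<epsilon> e) x v
    (gamma \<epsilon> x v *\<^sub>R Omega1 (- \<epsilon>) e x - beta \<epsilon> x v *\<^sub>R Omega2 \<epsilon> e x)"
proof -
  define r where "r = 1 / sqrt 2"
  have "r *\<^sub>R ((D (e 1) x v \<and>\<^sub>b e 4 x + e 1 x \<and>\<^sub>b D (e 4) x v) +
      \<epsilon> *\<^sub>R (D (e 2) x v \<and>\<^sub>b e 3 x + e 2 x \<and>\<^sub>b D (e 3) x v)) =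
    gamma \<epsilon> x v *\<^sub>R Omega1 (- \<epsilon>) e x - beta \<epsilon> x v *\<^sub>R Omega2 \<epsilon> e x"
    using assms unfolding Omega1_def Omega2_def r_def[symmetric]
    by (auto simp: D_e sum_4 \<omega>_simps beta_def gamma_def vec_eq_iff bivec_def algebra_simps)
  then show ?thesis
    using has_hat_D_e_pair[of r 1 4 \<epsilon> 2 3 x v] unfolding Omega3_def[abs_def] r_def by simp
qed

lemmas hat_D_Omega2 = hat_D_eqI[OF has_hat_D_Omega2]

text \<open>\<open>Omega1 (- \<epsilon>)\<close> is a space-like and
  \<open>Omega3 \<epsilon>\<close> a time-like unit, orthogonal to each other, so the light-like
  lines of their plane are spanned by their sum and their difference.\<close>

lemma hat_metric_Omega:
  assumes "\<epsilon> \<in> {1, - 1}"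
  shows "hat_metric (h x) (a *\<^sub>R Omega1 (- \<epsilon>) e x + b *\<^sub>R Omega3 \<epsilon> e x)
    (c *\<^sub>R Omega1 (- \<epsilon>) e x + d *\<^sub>R Omega3 \<epsilon> e x) = a * c - b * d"
  using assms
  unfolding Omega1_def Omega3_def hat_metric_add_left hat_metric_add_right hat_metric_scaleR_left
    hat_metric_scaleR_right hat_metric_h
  by (auto simp: inner_e field_simps)

lemma fully_light_like_iff:
  assumes "\<epsilon> \<in> {1, - 1}"
  shows "fully_light_like A h D (Omega2 \<epsilon> e) \<longleftrightarrow>
    (\<forall>x. (\<forall>v. (alpha \<epsilon> x v)\<^sup>2 = (beta \<epsilon> x v)\<^sup>2) \<and> (\<exists>v. alpha \<epsilon> x v \<noteq> 0))"
proof -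
  define \<theta> where "\<theta> x v = alpha \<epsilon> x v *\<^sub>R Omega1 (- \<epsilon>) e x + beta \<epsilon> x v *\<^sub>R Omega3 \<epsilon> e x" for x v
  have null: "light_like (h x) (\<theta> x v) \<or> \<theta> x v = 0 \<longleftrightarrow> (alpha \<epsilon> x v)\<^sup>2 = (beta \<epsilon> x v)\<^sup>2" for x v
  proof -
    have "hat_metric (h x) (\<theta> x v) (\<theta> x v) = (alpha \<epsilon> x v)\<^sup>2 - (beta \<epsilon> x v)\<^sup>2"
      by (simp add: \<theta>_def hat_metric_Omega[OF assms] power2_eq_square)
    then show ?thesis
      by (auto simp: light_like_def)
  qed
  have nonzero: "\<theta> x v \<noteq> 0 \<longleftrightarrow> alpha \<epsilon> x v \<noteq> 0" if "(alpha \<epsilon> x v)\<^sup>2 = (beta \<epsilon> x v)\<^sup>2" for x v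
  proof
    assume "\<theta> x v \<noteq> 0"
    then show "alpha \<epsilon> x v \<noteq> 0"
      using that by (auto simp: \<theta>_def)
  next
    assume "alpha \<epsilon> x v \<noteq> 0"
    \<comment> \<open>Pairing with \<open>Omega1 (- \<epsilon>)\<close> reads off the coefficient
      \<open>alpha\<close>.\<close>
    moreover have "hat_metric (h x) (\<theta> x v) (1 *\<^sub>R Omega1 (- \<epsilon>) e x + 0 *\<^sub>R Omega3 \<epsilon> e x) = alpha \<epsilon> x v"
      unfolding \<theta>_def hat_metric_Omega[OF assms] by simp
    ultimately show "\<theta> x v \<noteq> 0" by auto
  qed
  have "fully_light_like A h D (Omega2 \<epsilon> e) \<longleftrightarrow>
      (\<forall>x. (\<forall>v. light_like (h x) (\<theta> x v) \<or> \<theta> x v = 0) \<and> (\<exists>v. \<theta> x v \<noteq> 0))"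
    by (simp add: fully_light_like_def hat_D_Omega2[OF assms] \<theta>_def)
  then show ?thesis
    unfolding null using nonzero by blast
qed

text \<open>As \<epsilon> squares to 1, the equations for the fourth row of the connection form can
  be solved for \<open>alpha\<close>, \<open>beta\<close> and \<open>gamma\<close>.\<close>

lemma structure_equations_iff:
  assumes "\<epsilon> \<in> {1, - 1}" "\<mu> \<in> {1, - 1}"
  shows "structure_equations \<epsilon> \<mu> f g \<omega> \<longleftrightarrow>
    smooth_on UNIV f \<and> smooth_on UNIV g \<and> (\<forall>x. \<exists>v. diff_form g x v \<noteq> 0) \<and>
    (\<forall>x v. alpha \<epsilon> x v = exp (\<mu> * f x) * diff_form g x v) \<and>
    (\<forall>x v. beta \<epsilon> x v = \<mu> * alpha \<epsilon> x v) \<and>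
    (\<forall>x v. gamma \<epsilon> x v = - diff_form f x v)"
    (is "?L \<longleftrightarrow> ?R")
proof
  assume L: ?L
  have 41: "\<omega> 4 1 x v = \<epsilon> * exp (\<mu> * f x) * diff_form g x v - \<epsilon> * \<omega> 3 2 x v"
    and 42: "\<omega> 4 2 x v = \<epsilon> * \<omega> 3 1 x v - diff_form f x v"
    and 43: "\<omega> 4 3 x v = \<mu> * exp (\<mu> * f x) * diff_form g x v - \<epsilon> * \<omega> 2 1 x v" for x v
    using L by (simp_all add: structure_equations_def)
  show ?R
    using L assms unfolding structure_equations_def
    by (auto simp: alpha_def beta_def gamma_def 41 42 43)
next
  assume R: ?R
  have 41: "\<omega> 4 1 x v = \<epsilon> * exp (\<mu> * f x) * diff_form g x v - \<epsilon> * \<omega> 3 2 x v" for x v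
  proof -
    have "\<omega> 3 2 x v + \<epsilon> * \<omega> 4 1 x v = exp (\<mu> * f x) * diff_form g x v"
      using R by (simp add: alpha_def)
    then show ?thesis using assms by (auto simp: algebra_simps)
  qed
  have 42: "\<omega> 4 2 x v = \<epsilon> * \<omega> 3 1 x v - diff_form f x v" for x v
  proof -
    have "\<omega> 4 2 x v + - \<epsilon> * \<omega> 3 1 x v = - diff_form f x v"
      using R by (simp add: gamma_def)
    then show ?thesis by simp
  qed
  have 43: "\<omega> 4 3 x v = \<mu> * exp (\<mu> * f x) * diff_form g x v - \<epsilon> * \<omega> 2 1 x v" for x v
  proof -
    have "\<omega> 4 3 x v + \<epsilon> * \<omega> 2 1 x v = \<mu> * (exp (\<mu> * f x) * diff_form g x v)"
      using R by (simp add: beta_def)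
    then show ?thesis by simp
  qed
  have sm: "smooth_on UNIV f \<and> smooth_on UNIV g \<and> (\<forall>x. \<exists>v. diff_form g x v \<noteq> 0)"
    using R by blast
  show ?L
    \<comment> \<open>Flatness replaces each exterior derivative by wedge products; substituting
      \<open>41\<close>, \<open>42\<close> and \<open>43\<close> there produces the required
      right-hand sides.\<close>
    unfolding structure_equations_def structure_equation
    using sm 41 42 43 assms
    by (auto simp: sum_4 \<omega>_simps form_wedge_def 41 42 43 algebra_simps)
qed

end

section \<open>Boosted frames and potentials\<close>

text \<open>The matrix of the change of frame in \<open>boost_frame\<close>: a hyperbolic rotation
  mixing a space-like and a time-like vector.\<close>

definition boost :: "real \<Rightarrow> real^4^4" where
  "boost t = (\<chi> i j.
     if i = 2 \<and> j = 2 \<or> i = 4 \<and> j = 4 then cosh t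
     else if i = 2 \<and> j = 4 \<or> i = 4 \<and> j = 2 then sinh t
     else if i = j then 1 else 0)"

text \<open>Boosts form a one-parameter group, so the sign of the determinant follows without
  expanding it.\<close>

lemma boost_add: "boost s ** boost t = boost (s + t)"
  by (simp add: vec_eq_iff forall_4 matrix_matrix_mult_def sum_4 boost_def cosh_add sinh_add algebra_simps)

lemma boost_0: "boost 0 = mat 1"
  by (simp add: vec_eq_iff forall_4 boost_def mat_def)

(* A boost is the square of another boost, and invertible. *)
lemma det_boost_pos: "det (boost t) > 0"
proof -
  have "det (boost t) * det (boost (- t)) = 1"
    by (simp add: det_mul[symmetric] boost_add boost_0)
  then have "det (boost t) \<noteq> 0"
    by auto
  moreover have "det (boost t) = (det (boost (t / 2)))\<^sup>2"
    by (simp add: power2_eq_square det_mul[symmetric] boost_add)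
  ultimately show ?thesis
    by simp
qed

definition boost_frame ::
  "(real^'m \<Rightarrow> real) \<Rightarrow> (4 \<Rightarrow> real^'m \<Rightarrow> real^4) \<Rightarrow> 4 \<Rightarrow> real^'m \<Rightarrow> real^4" where
  "boost_frame f e i =
     (if i = 2 then \<lambda>x. cosh (f x) *\<^sub>R e 2 x + sinh (f x) *\<^sub>R e 4 x
      else if i = 4 then \<lambda>x. sinh (f x) *\<^sub>R e 2 x + cosh (f x) *\<^sub>R e 4 x
      else e i)"

lemma boost_frame_simps [simp]:
  "boost_frame f e 1 x = e 1 x"
  "boost_frame f e 2 x = cosh (f x) *\<^sub>R e 2 x + sinh (f x) *\<^sub>R e 4 x"
  "boost_frame f e 3 x = e 3 x"
  "boost_frame f e 4 x = sinh (f x) *\<^sub>R e 2 x + cosh (f x) *\<^sub>R e 4 x"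
  by (simp_all add: boost_frame_def)

text \<open>The frame vectors are the columns, so changing the frame multiplies by the boost on the
  right, and its determinant is positive.\<close>

lemma gives_orientation_boost_frame:
  assumes "gives_orientation A e"
  shows "gives_orientation A (boost_frame f e)"
proof -
  have "(\<chi> i j. (F x *v boost_frame f e j x) $ i) = (\<chi> i j. (F x *v e j x) $ i) ** boost (f x)"
    for F :: "real^'a \<Rightarrow> real^4^4" and x
    by (simp add: vec_eq_iff forall_4 matrix_matrix_mult_def sum_4 boost_def matrix_vector_right_distrib
        matrix_vector_mult_scaleR algebra_simps)
  then show ?thesis
    using assms det_boost_pos by (auto simp: gives_orientation_def det_mul)
qed

text \<open>The boost leaves e_1 and e_3 alone and has determinant 1 on the plane of e_2 and e_4,
  hence keeps e_4 \<and> e_2.\<close>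

lemma Omega2_boost_frame: "Omega2 \<epsilon> (boost_frame f e) = Omega2 \<epsilon> e"
proof
  fix x
  have "(s *\<^sub>R e 2 x + c *\<^sub>R e 4 x) \<and>\<^sub>b (c *\<^sub>R e 2 x + s *\<^sub>R e 4 x) = (c\<^sup>2 - s\<^sup>2) *\<^sub>R (e 4 x \<and>\<^sub>b e 2 x)" for c s
    by (simp add: vec_eq_iff bivec_def power2_eq_square algebra_simps)
  then show "Omega2 \<epsilon> (boost_frame f e) x = Omega2 \<epsilon> e x"
    by (simp add: Omega2_def cosh_square_eq)
qed

text \<open>On the plane of \<open>Omega1 (- \<epsilon>)\<close> and
  \<open>Omega3 \<epsilon>\<close> the boost is again a hyperbolic rotation, and
  \<open>Omega0\<close> spans one of its light-like eigenlines.\<close>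

lemma Omega0_boost_frame:
  assumes "\<mu> \<in> {1, - 1}"
  shows "Omega0 \<epsilon> \<mu> (boost_frame f e) x = exp (\<mu> * f x) *\<^sub>R Omega0 \<epsilon> \<mu> e x"
proof -
  have "exp (\<mu> * f x) = cosh (f x) + \<mu> * sinh (f x)"
    using assms cosh_plus_sinh[of "f x"] cosh_minus_sinh[of "f x"] by auto
  then show ?thesis
    using assms
    by (auto simp: Omega0_def Omega1_def Omega3_def vec_eq_iff bivec_def algebra_simps)
qed

context neutral_bundle
begin

lemma pseudo_orthonormal_frame_boost_frame:
  assumes "smooth_on UNIV f"
  shows "pseudo_orthonormal_frame A h (boost_frame f e)"
  unfolding pseudo_orthonormal_frame_def
proof (intro conjI allI)
  fix i
  note sections = smooth_section_add[OF oriented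
      smooth_section_scaleR[OF oriented _ smooth_e] smooth_section_scaleR[OF oriented _ smooth_e]]
  show "smooth_section A (boost_frame f e i)"
    using smooth_on_cosh_sinh[OF open_UNIV assms] by (simp add: boost_frame_def sections smooth_e)
next
  fix x
  note lin = bilinear_ladd[OF bilinear_h] bilinear_radd[OF bilinear_h]
    bilinear_lmul[OF bilinear_h] bilinear_rmul[OF bilinear_h]
  have "cosh (f x) * cosh (f x) = sinh (f x) * sinh (f x) + 1"
    using cosh_square_eq[of "f x"] by (simp add: power2_eq_square)
  then show "pseudo_orthonormal (h x) (\<lambda>i. boost_frame f e i x)"
    by (simp add: pseudo_orthonormal_def forall_4 lin inner_e)
qed

end

section \<open>The potentials f and g, and the horizontal light-like section\<close>

context flat_neutral_bundle
begin

lemma fully_light_like_imp_structure_equations: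
  assumes \<epsilon>: "\<epsilon> \<in> {1, - 1}" and "fully_light_like A h D (Omega2 \<epsilon> e)"
  shows "\<exists>f g. \<exists>\<mu>\<in>{1, - 1}. structure_equations \<epsilon> \<mu> f g \<omega>"
proof -
  have sq: "(alpha \<epsilon> x v)\<^sup>2 = (beta \<epsilon> x v)\<^sup>2" and nz: "\<exists>v. alpha \<epsilon> x v \<noteq> 0" for x v
    using assms by (simp_all add: fully_light_like_iff)
  obtain \<mu> where \<mu>: "\<mu> \<in> {1, - 1}" and beta: "\<And>x v. beta \<epsilon> x v = \<mu> * alpha \<epsilon> x v"
    using one_forms_equal_squares[OF linear_alpha linear_beta smooth_on_continuous[OF smooth_alpha]
        smooth_on_continuous[OF smooth_beta] sq nz] by blast
  \<comment> \<open>\<open>alpha\<close> and \<open>beta\<close> are proportional, so their wedge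
    product vanishes.\<close>
  have "ext_d (gamma \<epsilon>) x u v = 0" for x u v
    by (simp add: ext_d_gamma[OF \<epsilon>] form_wedge_def beta)
  then obtain k where k: "smooth_on UNIV k" "\<And>x. diff_form k x = gamma \<epsilon> x"
    using closed_form_exact[OF linear_gamma smooth_gamma] by blast
  \<comment> \<open>The sign is chosen to get gamma = - df; the product form lets
    \<open>smooth_on_mult\<close> apply.\<close>
  define f where "f x = - 1 * k x" for x
  have f_smooth: "smooth_on UNIV f"
    unfolding f_def by (intro smooth_on_mult smooth_on_const k open_UNIV)
  have f_deriv: "(f has_derivative (\<lambda>v. - gamma \<epsilon> x v)) (at x)" for x
    using has_derivative_minus[OF smooth_on_has_derivative[OF k(1) UNIV_I, of x]]
    by (simp add: f_def[abs_def] k(2))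
  have gamma: "gamma \<epsilon> x v = - diff_form f x v" for x v
    by (simp add: diff_form_eqI[OF f_deriv])
  \<comment> \<open>An integrating factor for \<open>alpha\<close>.\<close>
  define \<phi> where "\<phi> x = exp (- \<mu> * f x)" for x
  have \<phi>_smooth: "smooth_on UNIV \<phi>"
    unfolding \<phi>_def by (intro smooth_on_exp smooth_on_mult smooth_on_const f_smooth open_UNIV)
  have \<phi>_deriv: "(\<phi> has_derivative (\<lambda>v. \<phi> x * (\<mu> * gamma \<epsilon> x v))) (at x)" for x
    unfolding \<phi>_def
    by (rule has_derivative_eq_rhs[OF has_derivative_exp[OF has_derivative_mult_right[OF f_deriv]]])
      (simp add: fun_eq_iff)
  have "ext_d (\<lambda>x v. \<phi> x * alpha \<epsilon> x v) x u v = 0" for x u v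
  proof -
    have "(\<lambda>y. alpha \<epsilon> y w) differentiable (at x)" for w
      using smooth_on_has_derivative[OF smooth_alpha] by (blast intro: differentiableI)
    \<comment> \<open>The derivative of \<phi> contributes \<mu> \<phi> gamma \<and> alpha, and
      \<phi> d alpha = \<phi> beta \<and> gamma = \<mu> \<phi> alpha \<and> gamma cancels
      it.\<close>
    from ext_d_function_mult[of \<phi> _ x "alpha \<epsilon>" u v, OF \<phi>_deriv this] show ?thesis
      by (simp add: ext_d_alpha[OF \<epsilon>] form_wedge_def beta algebra_simps)
  qed
  moreover have "linear (\<lambda>v. \<phi> x * alpha \<epsilon> x v)" for x
    by (rule linearI)
      (simp_all add: linear_add[OF linear_alpha] linear_cmul[OF linear_alpha] algebra_simps)
  moreover have "smooth_on UNIV (\<lambda>x. \<phi> x * alpha \<epsilon> x v)" for v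
    by (intro smooth_on_mult \<phi>_smooth smooth_alpha open_UNIV)
  ultimately obtain g where g: "smooth_on UNIV g" "\<And>x. diff_form g x = (\<lambda>v. \<phi> x * alpha \<epsilon> x v)"
    using closed_form_exact[of "\<lambda>x v. \<phi> x * alpha \<epsilon> x v"] by blast
  have "exp (\<mu> * f x) * \<phi> x = 1" for x
    by (simp add: \<phi>_def exp_minus_inverse)
  then have "alpha \<epsilon> x v = exp (\<mu> * f x) * diff_form g x v" for x v
    by (simp add: g(2) mult.assoc[symmetric])
  moreover have "\<exists>v. diff_form g x v \<noteq> 0" for x
    using nz[of x] by (simp add: g(2) \<phi>_def)
  ultimately have "structure_equations \<epsilon> \<mu> f g \<omega>"
    unfolding structure_equations_iff[OF \<epsilon> \<mu>] using f_smooth g(1) beta gamma by blast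
  with \<mu> show ?thesis by blast
qed

lemma structure_equations_imp_fully_light_like:
  assumes \<epsilon>: "\<epsilon> \<in> {1, - 1}" and \<mu>: "\<mu> \<in> {1, - 1}" and "structure_equations \<epsilon> \<mu> f g \<omega>"
  shows "fully_light_like A h D (Omega2 \<epsilon> e)"
  using assms(3) \<mu> unfolding fully_light_like_iff[OF \<epsilon>] structure_equations_iff[OF \<epsilon> \<mu>]
  by (auto simp: power_mult_distrib)

lemma hat_D_Omega2_structure_equations:
  assumes \<epsilon>: "\<epsilon> \<in> {1, - 1}" and \<mu>: "\<mu> \<in> {1, - 1}" and "structure_equations \<epsilon> \<mu> f g \<omega>"
  shows "hat_D A D (Omega2 \<epsilon> e) x v = (exp (\<mu> * f x) * diff_form g x v) *\<^sub>R Omega0 \<epsilon> \<mu> e x"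
  using assms(3) unfolding structure_equations_iff[OF \<epsilon> \<mu>] hat_D_Omega2[OF \<epsilon>]
  by (simp add: Omega0_def scaleR_right_distrib mult.commute)

lemma hat_D_Omega0_boost_frame:
  assumes \<epsilon>: "\<epsilon> \<in> {1, - 1}" and \<mu>: "\<mu> \<in> {1, - 1}" and "structure_equations \<epsilon> \<mu> f g \<omega>"
  shows "hat_D A D (Omega0 \<epsilon> \<mu> (boost_frame f e)) x v = 0"
proof -
  have f: "smooth_on UNIV f" and beta: "beta \<epsilon> x v = \<mu> * alpha \<epsilon> x v"
    and gamma: "gamma \<epsilon> x v = - diff_form f x v"
    using assms(3) by (simp_all add: structure_equations_iff[OF \<epsilon> \<mu>])
  have "has_hat_D A D (\<lambda>y. Omega1 (- \<epsilon>) e y + \<mu> *\<^sub>R Omega3 \<epsilon> e y) x v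
    ((alpha \<epsilon> x v *\<^sub>R Omega2 \<epsilon> e x + gamma \<epsilon> x v *\<^sub>R Omega3 \<epsilon> e x) +
     \<mu> *\<^sub>R (gamma \<epsilon> x v *\<^sub>R Omega1 (- \<epsilon>) e x - beta \<epsilon> x v *\<^sub>R Omega2 \<epsilon> e x))"
    using has_hat_D_add[OF has_hat_D_Omega1[OF \<epsilon>, of x v]
        has_hat_D_scaleR[OF oriented connection smooth_on_const[of UNIV \<mu>] has_hat_D_Omega3[OF \<epsilon>]]]
    by simp
  \<comment> \<open>Since beta = \<mu> alpha and \<mu> squares to 1, the coefficient of
    \<open>Omega2\<close> vanishes; the rest is \<mu> gamma times \<open>Omega0\<close>.\<close>
  moreover have "(alpha \<epsilon> x v *\<^sub>R Omega2 \<epsilon> e x + gamma \<epsilon> x v *\<^sub>R Omega3 \<epsilon> e x) +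
     \<mu> *\<^sub>R (gamma \<epsilon> x v *\<^sub>R Omega1 (- \<epsilon>) e x - beta \<epsilon> x v *\<^sub>R Omega2 \<epsilon> e x) =
     - (\<mu> * diff_form f x v) *\<^sub>R Omega0 \<epsilon> \<mu> e x"
    using \<mu> by (auto simp: Omega0_def beta gamma scaleR_right_distrib)
  ultimately have Omega0: "has_hat_D A D (Omega0 \<epsilon> \<mu> e) x v (- (\<mu> * diff_form f x v) *\<^sub>R Omega0 \<epsilon> \<mu> e x)"
    by (simp add: Omega0_def[abs_def])
  have "((\<lambda>y. exp (\<mu> * f y)) has_derivative (\<lambda>v. exp (\<mu> * f x) * (\<mu> * diff_form f x v))) (at x)"
    by (rule has_derivative_eq_rhs[OF has_derivative_exp[OF has_derivative_mult_right
            [OF smooth_on_has_derivative[OF f UNIV_I]]]])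
      (simp add: fun_eq_iff)
  note exp_deriv = diff_form_eqI[OF this]
  have "smooth_on UNIV (\<lambda>y. exp (\<mu> * f y))"
    by (intro smooth_on_exp smooth_on_mult smooth_on_const f open_UNIV)
  \<comment> \<open>The boosted section is exp(\<mu> f) times \<open>Omega0\<close>; differentiating
    the factor gives exactly the opposite of the term from \<open>Omega0\<close>.\<close>
  from has_hat_D_scaleR[OF oriented connection this Omega0]
  have "has_hat_D A D (Omega0 \<epsilon> \<mu> (boost_frame f e)) x v 0"
    by (simp add: exp_deriv Omega0_boost_frame[OF \<mu>, abs_def] scaleR_left_distrib[symmetric])
  then show ?thesis
    by (rule hat_D_eqI)
qed

end

theorem proposition9p1:
  fixes A :: "('m::finite, 4) atlas"
    and h :: "real^'m \<Rightarrow> real^4 \<Rightarrow> real^4 \<Rightarrow> real"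
    and D :: "('m, 4) cov_deriv"
    and e :: "4 \<Rightarrow> real^'m \<Rightarrow> real^4"
    and \<omega> :: "4 \<Rightarrow> 4 \<Rightarrow> real^'m \<Rightarrow> real^'m \<Rightarrow> real"
    and \<epsilon> :: real
  assumes "CARD('m) \<ge> 2"
    and "oriented_bundle A"
    and "neutral_metric A h"
    and "metric_connection A h D"
    and "flat A D"
    and "pseudo_orthonormal_frame A h e"
    and "gives_orientation A e"
    and "connection_form D e \<omega>"
    and "\<epsilon> \<in> {1, - 1}"
  shows "(fully_light_like A h D (Omega2 \<epsilon> e) \<longleftrightarrow>
            (\<exists>f g. \<exists>\<mu>\<in>{1, - 1}. structure_equations \<epsilon> \<mu> f g \<omega>)) \<and>
         (\<forall>f g. \<forall>\<mu>\<in>{1, - 1}. structure_equations \<epsilon> \<mu> f g \<omega> \<longrightarrow>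
            (\<forall>x v. hat_D A D (Omega2 \<epsilon> e) x v =
               (exp (\<mu> * f x) * diff_form g x v) *\<^sub>R Omega0 \<epsilon> \<mu> e x) \<and>
            (\<exists>e'. pseudo_orthonormal_frame A h e' \<and> gives_orientation A e' \<and>
               Omega2 \<epsilon> e' = Omega2 \<epsilon> e \<and>
               (\<forall>x v. hat_D A D (Omega0 \<epsilon> \<mu> e') x v = 0)))"
proof -
  interpret flat_neutral_bundle A h D e \<omega>
    using assms by unfold_locales
  note \<epsilon> = assms(9)
  show ?thesis
  proof (intro conjI allI ballI impI)
    show "fully_light_like A h D (Omega2 \<epsilon> e) \<longleftrightarrow>
        (\<exists>f g. \<exists>\<mu>\<in>{1, - 1}. structure_equations \<epsilon> \<mu> f g \<omega>)"
      using fully_light_like_imp_structure_equations[OF \<epsilon>]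
        structure_equations_imp_fully_light_like[OF \<epsilon>] by blast
  next
    fix f g and \<mu> :: real
    assume \<mu>: "\<mu> \<in> {1, - 1}" and eqs: "structure_equations \<epsilon> \<mu> f g \<omega>"
    show "hat_D A D (Omega2 \<epsilon> e) x v = (exp (\<mu> * f x) * diff_form g x v) *\<^sub>R Omega0 \<epsilon> \<mu> e x" for x v
      by (rule hat_D_Omega2_structure_equations[OF \<epsilon> \<mu> eqs])
    have "smooth_on UNIV f"
      using eqs by (simp add: structure_equations_def)
    \<comment> \<open>The witness is the boost by the potential f itself; smoothness of f makes it a
      smooth frame.\<close>
    then show "\<exists>e'. pseudo_orthonormal_frame A h e' \<and> gives_orientation A e' \<and>
        Omega2 \<epsilon> e' = Omega2 \<epsilon> e \<and> (\<forall>x v. hat_D A D (Omega0 \<epsilon> \<mu> e') x v = 0)"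
      using pseudo_orthonormal_frame_boost_frame gives_orientation_boost_frame[OF assms(7)]
        Omega2_boost_frame hat_D_Omega0_boost_frame[OF \<epsilon> \<mu> eqs]
      by (intro exI[of _ "boost_frame f e"] conjI allI)
  qed
qed

end
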